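(* Let $r\ge1$ and $n\ge1$. The number of $r$-permutations $\pi$ of $[n]$ such that $S(S(\pi))$ is the identity permutation $12\cdots n$ equals $$2(r+1)\frac{((2r+1)n)!}{n!\,(2rn+2)!}.$$
   Context: An $r$-permutation of a finite set $A$ of positive integers is a word in which each element of $A$ appears exactly $r$ times such that whenever $i<j<k$ and $a_i=a_k$ we have $a_j\le a_i$; for $A=[n]$ it is an $r$-permutation of $[n]$. Stack sorting $S$: on words with distinct letters, $S(\emptyset)=\emptyset$ and $S(\pi_lm\pi_r)=S(\pi_l)S(\pi_r)m$ where $m$ is the largest letter; on a nonempty $r$-permutation $\pi$ with largest letter $m$, written $\pi=\alpha_1m\alpha_2m\cdots m\alpha_{r+1}$, $S(\pi)=S(\alpha_1)\cdots S(\alpha_{r+1})m$, and $S(\emptyset)=\emptyset$. *)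

theory Defs
  imports Complex_Main
begin

definition r_permutation :: "nat \<Rightarrow> nat set \<Rightarrow> nat list \<Rightarrow> bool" where
  "r_permutation r A w \<longleftrightarrow>
     set w \<subseteq> A \<and>
     (\<forall>a\<in>A. count_list w a = r) \<and>
     (\<forall>i j k. i < j \<and> j < k \<and> k < length w \<and> w ! i = w ! k \<longrightarrow> w ! j \<le> w ! i)"

(* The blocks \<alpha>_1, ..., \<alpha>_{s+1} of a word \<alpha>_1 m \<alpha>_2 m ... m \<alpha>_{s+1} in which the letter m
   occurs s times; empty blocks are kept. *)
primrec blocks :: "'a \<Rightarrow> 'a list \<Rightarrow> 'a list list" where
  "blocks m [] = [[]]"
| "blocks m (x # xs) =
     (if x = m then [] # blocks m xs
      else (x # hd (blocks m xs)) # tl (blocks m xs))"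

lemma blocks_nonempty [simp]: "blocks m w \<noteq> []"
  by (cases w) auto

lemma length_blocks: "length (blocks m w) = count_list w m + 1"
  by (induction w) (auto simp: Suc_diff_Suc)

lemma length_block_le: "b \<in> set (blocks m w) \<Longrightarrow> length b \<le> length w"
proof (induction w arbitrary: b)
  case (Cons x w)
  have "hd (blocks m w) \<in> set (blocks m w)" by simp
  moreover have "set (tl (blocks m w)) \<subseteq> set (blocks m w)" by (cases "blocks m w") auto
  ultimately show ?case
    using Cons by (auto split: if_splits intro: le_SucI)
qed simp

lemma length_block_less: "m \<in> set w \<Longrightarrow> b \<in> set (blocks m w) \<Longrightarrow> length b < length w"
proof (induction w arbitrary: b)
  case (Cons x w)
  have hd: "hd (blocks m w) \<in> set (blocks m w)" by simp
  have tl: "set (tl (blocks m w)) \<subseteq> set (blocks m w)" by (cases "blocks m w") auto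
  show ?case
  proof (cases "x = m")
    case True
    then show ?thesis using Cons.prems length_block_le[of b m w] by auto
  next
    case False
    then have "m \<in> set w" using Cons.prems by simp
    then have "length c < length w" if "c \<in> set (blocks m w)" for c
      using Cons.IH that by blast
    then show ?thesis
      using Cons.prems False hd tl by (auto intro: less_SucI)
  qed
qed simp

lemma blocks_not_in: "m \<notin> set w \<Longrightarrow> blocks m w = [w]"
  by (induction w) auto

lemma blocks_append: "m \<notin> set u \<Longrightarrow> blocks m (u @ m # v) = u # blocks m v"
  by (induction u) auto

(* Stack sorting, on arbitrary words: all copies of the largest letter m are removed, the blocks
   between them are sorted recursively, and a single m is appended. On words with distinct letters
   there are exactly two blocks, so the same function also is the classical map
   (lemma stack_sort_split below). *)
function stack_sort :: "nat list \<Rightarrow> nat list" where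
  "stack_sort [] = []"
| "stack_sort (x # xs) =
     (let m = Max (set (x # xs))
      in concat (map stack_sort (blocks m (x # xs))) @ [m])"
  by pat_completeness auto
termination
proof (relation "measure length", simp)
  fix x xs m b
  assume "m = Max (set (x # xs))" "b \<in> set (blocks m (x # xs))"
  moreover have "Max (set (x # xs)) \<in> set (x # xs)" by (rule Max_in) auto
  ultimately have "length b < length (x # xs)" by (intro length_block_less) auto
  then show "(b, x # xs) \<in> measure length" by simp
qed

lemma stack_sort_nonempty:
  assumes "m \<in> set w" "\<And>x. x \<in> set w \<Longrightarrow> x \<le> m"
  shows "stack_sort w = concat (map stack_sort (blocks m w)) @ [m]"
proof -
  have "Max (set w) = m" using assms by (intro Max_eqI) auto
  then show ?thesis using assms(1) by (cases w) (auto simp: Let_def simp del: blocks.simps)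
qed

lemma stack_sort_split:
  assumes "\<And>x. x \<in> set u \<union> set v \<Longrightarrow> x < m"
  shows "stack_sort (u @ m # v) = stack_sort u @ stack_sort v @ [m]"
proof -
  have "m \<notin> set u" "m \<notin> set v" using assms by auto
  then have "blocks m (u @ m # v) = [u, v]" by (simp add: blocks_append blocks_not_in)
  moreover have "stack_sort (u @ m # v) = concat (map stack_sort (blocks m (u @ m # v))) @ [m]"
    using assms by (intro stack_sort_nonempty) (auto intro: less_imp_le)
  ultimately show ?thesis by simp
qed

end

theory Submission
  imports Defs "HOL-Computational_Algebra.Formal_Power_Series"
begin

text \<open>
  \<open>S(S(\<pi>))\<close> is the identity iff \<open>\<sigma> = S(\<pi>)\<close> avoids 231, and \<open>\<pi>\<close> is an \<open>(r+1)\<close>-ary decreasing tree whose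
  postorder word is \<open>\<sigma>\<close>. Let \<open>F\<^sub>j(x,u)\<close> count lists of \<open>j\<close> such (possibly empty) trees with 231-avoiding
  concatenated postorder word, \<open>u\<close> marking the number of direct sum components of that word. Putting a
  nonempty tree in front of a forest with word \<open>v\<close> keeps the word 231-avoiding iff all letters of the
  tree except its root \<open>m\<close> are below \<open>v\<close> and \<open>m\<close> falls between two components of \<open>v\<close> in value. Hence
  \<open>F\<^sub>j\<^sub>+\<^sub>1 = F\<^sub>j + T (u F\<^sub>j - F\<^sub>j(x,1)) / (u - 1)\<close> with \<open>F\<^sub>0 = 1\<close> and \<open>T = x u F\<^sub>r\<^sub>+\<^sub>1\<close>, and the answer is the
  coefficient of \<open>x^n\<close> in \<open>T(x,1)\<close>.

  Eliminating the \<open>F\<^sub>j\<close> gives, for \<open>A = 1 + u T / (u - 1)\<close>, an equation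
  \<open>1 + x Q(A) = 1/u + x u A^(r+1) / (A - 1)\<close> with \<open>Q\<close> a polynomial of degree \<open>r\<close>. It is uniformised by
  \<open>x = t (1 - t)^(2r)\<close>, \<open>u = (1 + v) / (1 + t v)^(r+1)\<close>, where \<open>v \<mapsto> 1/v\<close> fixes \<open>A\<close> and exchanges the two
  solutions \<open>u\<close>. This yields \<open>T(x,1) = t (1 - (r+1) t) / (1 - t)^2\<close>, and Lagrange inversion finishes.
\<close>

unbundle fps_syntax

section \<open>Series and forms\<close>

text \<open>Forms of degree \<open>k\<close> in the variable and \<open>p\<close>, that is,
  \<open>X^k\<close> times a polynomial of degree at most \<open>k\<close> in \<open>p / X\<close>.
  Clearing the denominator lets polynomials in \<open>A\<close>, which has a pole, be handled as
  power series.\<close>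

definition homogeneous :: "'a::comm_ring_1 fps \<Rightarrow> nat \<Rightarrow> 'a fps set" where
  "homogeneous p k = range (\<lambda>c. \<Sum>i\<le>k. fps_const (c i) * fps_X ^ i * p ^ (k - i))"

lemma homogeneousI:
  "x = (\<Sum>i\<le>k. fps_const (c i) * fps_X ^ i * p ^ (k - i)) \<Longrightarrow> x \<in> homogeneous p k"
  by (auto simp: homogeneous_def)

lemma homogeneousE:
  assumes "x \<in> homogeneous p k"
  obtains c where "x = (\<Sum>i\<le>k. fps_const (c i) * fps_X ^ i * p ^ (k - i))"
  using assms by (auto simp: homogeneous_def)

lemma homogeneous_add:
  assumes "x \<in> homogeneous p k" "y \<in> homogeneous p k"
  shows "x + y \<in> homogeneous p k"
proof -
  obtain c d where "x = (\<Sum>i\<le>k. fps_const (c i) * fps_X ^ i * p ^ (k - i))"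
    "y = (\<Sum>i\<le>k. fps_const (d i) * fps_X ^ i * p ^ (k - i))"
    using assms by (auto elim!: homogeneousE)
  then have "x + y = (\<Sum>i\<le>k. fps_const (c i + d i) * fps_X ^ i * p ^ (k - i))"
    by (simp add: sum.distrib [symmetric] algebra_simps flip: fps_const_add)
  then show ?thesis by (rule homogeneousI)
qed

lemma homogeneous_const_mult:
  assumes "x \<in> homogeneous p k"
  shows "fps_const e * x \<in> homogeneous p k"
proof -
  obtain c where "x = (\<Sum>i\<le>k. fps_const (c i) * fps_X ^ i * p ^ (k - i))"
    using assms by (auto elim!: homogeneousE)
  then have "fps_const e * x = (\<Sum>i\<le>k. fps_const (e * c i) * fps_X ^ i * p ^ (k - i))"
    by (simp add: sum_distrib_left mult.assoc flip: fps_const_mult)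
  then show ?thesis by (rule homogeneousI)
qed

lemma homogeneous_diff:
  assumes "x \<in> homogeneous p k" "y \<in> homogeneous p k"
  shows "x - y \<in> homogeneous p k"
  using homogeneous_add[OF assms(1) homogeneous_const_mult[OF assms(2), of "-1"]]
  by (simp add: fps_const_neg [symmetric] del: fps_const_neg)

lemma homogeneous_X_mult:
  assumes "x \<in> homogeneous p k"
  shows "fps_X * x \<in> homogeneous p (Suc k)"
proof -
  obtain c where "x = (\<Sum>i\<le>k. fps_const (c i) * fps_X ^ i * p ^ (k - i))"
    using assms by (auto elim!: homogeneousE)
  then have "fps_X * x = (\<Sum>i\<le>Suc k. fps_const (case i of 0 \<Rightarrow> 0 | Suc j \<Rightarrow> c j) * fps_X ^ i * p ^ (Suc k - i))"
    unfolding sum.atMost_Suc_shift by (simp add: sum_distrib_left algebra_simps)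
  then show ?thesis by (rule homogeneousI)
qed

lemma homogeneous_base_mult:
  assumes "x \<in> homogeneous p k"
  shows "p * x \<in> homogeneous p (Suc k)"
proof -
  obtain c where "x = (\<Sum>i\<le>k. fps_const (c i) * fps_X ^ i * p ^ (k - i))"
    using assms by (auto elim!: homogeneousE)
  then have "p * x = (\<Sum>i\<le>Suc k. fps_const (if i \<le> k then c i else 0) * fps_X ^ i * p ^ (Suc k - i))"
    by (auto simp: sum_distrib_left algebra_simps Suc_diff_le intro!: sum.cong)
  then show ?thesis by (rule homogeneousI)
qed

lemma homogeneous_X_power: "fps_X ^ k \<in> homogeneous p k"
proof (rule homogeneousI)
  have "(\<Sum>i\<le>k. fps_const (if i = k then 1 else 0) * fps_X ^ i * p ^ (k - i))
      = (\<Sum>i\<le>k. if i = k then fps_X ^ k else 0)"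
    by (intro sum.cong) auto
  then show "fps_X ^ k = (\<Sum>i\<le>k. fps_const (if i = k then 1 else 0) * fps_X ^ i * p ^ (k - i))"
    by simp
qed

text \<open>Carries the forms in \<open>g * h\<close> from \<open>kernel_identity\<close> over to
  the base \<open>a\<close>, a constant multiple of \<open>g * h\<close>.\<close>

lemma homogeneous_scale:
  assumes "x \<in> homogeneous p k"
  shows "fps_const s ^ k * x \<in> homogeneous (fps_const s * p) k"
proof -
  obtain c where "x = (\<Sum>i\<le>k. fps_const (c i) * fps_X ^ i * p ^ (k - i))"
    using assms by (auto elim!: homogeneousE)
  moreover have "fps_const s ^ k * (fps_const (c i) * fps_X ^ i * p ^ (k - i)) =
      fps_const (c i * s ^ i) * fps_X ^ i * (fps_const s * p) ^ (k - i)" if "i \<le> k" for i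
  proof -
    have "fps_const s ^ k = fps_const s ^ i * fps_const s ^ (k - i)"
      using that by (simp flip: power_add)
    then show ?thesis by (simp add: power_mult_distrib algebra_simps flip: fps_const_mult fps_const_power)
  qed
  ultimately have "fps_const s ^ k * x =
      (\<Sum>i\<le>k. fps_const (c i * s ^ i) * fps_X ^ i * (fps_const s * p) ^ (k - i))"
    by (simp add: sum_distrib_left)
  then show ?thesis by (rule homogeneousI)
qed

text \<open>If \<open>c i\<close> is the first nonzero coefficient of a form, the form has order
  exactly \<open>i\<close>, at most \<open>k\<close>, and \<open>b\<close> has order 0, so the
  product cannot be divisible by \<open>X^(k+1)\<close>. The induction shows the coefficients to be
  zero one at a time.\<close>

lemma homogeneous_divisible_eq_0:
  fixes a b :: "'a::idom fps"
  assumes "a $ 0 \<noteq> 0" "b $ 0 \<noteq> 0"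
  shows "x \<in> homogeneous a k \<Longrightarrow> fps_X ^ Suc k * e = b * x \<Longrightarrow> e = 0"
proof (induction k arbitrary: x)
  case 0
  then obtain c where c: "x = fps_const c" by (auto elim!: homogeneousE)
  have "(b * x) $ 0 = 0" unfolding 0(2) [symmetric] by simp
  then have "c = 0" using c assms by simp
  then have "fps_X * e = 0" using c 0(2) by simp
  then show ?case by simp
next
  case (Suc k)
  then obtain c where c: "x = (\<Sum>i\<le>Suc k. fps_const (c i) * fps_X ^ i * a ^ (Suc k - i))"
    by (auto elim!: homogeneousE)
  define y where "y = (\<Sum>i\<le>k. fps_const (c (Suc i)) * fps_X ^ i * a ^ (k - i))"
  have x: "x = fps_const (c 0) * a ^ Suc k + fps_X * y"
    unfolding c y_def sum.atMost_Suc_shift by (simp add: sum_distrib_left algebra_simps)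
  have "(b * x) $ 0 = 0"
    unfolding Suc.prems(2) [symmetric] by simp
  then have "c 0 = 0" using assms by (simp add: x fps_nth_power_0)
  then have "fps_X * (fps_X ^ Suc k * e) = fps_X * (b * y)"
    using Suc.prems(2) x by (simp add: algebra_simps)
  then have "fps_X ^ Suc k * e = b * y" by simp
  moreover have "y \<in> homogeneous a k" unfolding y_def by (rule homogeneousI) simp
  ultimately show ?case using Suc.IH by blast
qed

text \<open>In homogeneous form, this says that \<open>(1/u + 1/u' - 1) / t\<close> is a polynomial in \<open>A\<close>, where \<open>u\<close> and \<open>u'\<close>
  are the two solutions with the same \<open>A\<close>. Both summands on the left satisfy the linear recurrence with
  roots \<open>v g\<close> and \<open>h\<close>, whose sum and product are polynomials in \<open>v\<close> and \<open>g h\<close>.\<close>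

lemma kernel_identity:
  fixes t :: "'a::comm_ring_1"
  defines "g \<equiv> 1 + fps_const t * fps_X" and "h \<equiv> fps_X + fps_const t"
  shows "\<exists>x \<in> homogeneous (g * h) k.
    fps_X ^ k * g ^ Suc k + h ^ Suc k = (1 + fps_X) * (fps_X ^ k + fps_const t * x)"
proof (induction k rule: induct_nat_012)
  case 0
  have "1 \<in> homogeneous (g * h) 0" using homogeneous_X_power[of 0] by simp
  then show ?case by (intro bexI[of _ 1]) (auto simp: g_def h_def algebra_simps)
next
  case 1
  let ?x = "g * h + fps_const (1 - t - t\<^sup>2) * fps_X"
  have "1 \<in> homogeneous (g * h) 0" using homogeneous_X_power[of 0] by simp
  from homogeneous_base_mult[OF this] have "g * h \<in> homogeneous (g * h) (Suc 0)" by simp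
  moreover have "fps_X \<in> homogeneous (g * h) (Suc 0)"
    using homogeneous_X_power[of "Suc 0" "g * h"] by simp
  ultimately have "?x \<in> homogeneous (g * h) (Suc 0)"
    by (intro homogeneous_add homogeneous_const_mult)
  moreover have coeff: "fps_const (1 - t - t\<^sup>2) = 1 - fps_const t - fps_const t ^ 2"
    by (simp flip: fps_const_sub)
  have "fps_X ^ Suc 0 * g ^ Suc (Suc 0) + h ^ Suc (Suc 0)
      = (1 + fps_X) * (fps_X ^ Suc 0 + fps_const t * ?x)"
    unfolding coeff g_def h_def
    by (simp add: algebra_simps power2_eq_square del: fps_const_mult)
  ultimately show ?case by blast
next
  case (ge2 k)
  let ?p = "g * h" and ?X = "fps_X :: 'a fps" and ?t = "fps_const t"
  obtain x y where x: "x \<in> homogeneous ?p k" "y \<in> homogeneous ?p (Suc k)"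
    and eq: "?X ^ k * g ^ Suc k + h ^ Suc k = (1 + ?X) * (?X ^ k + ?t * x)"
      "?X ^ Suc k * g ^ Suc (Suc k) + h ^ Suc (Suc k) = (1 + ?X) * (?X ^ Suc k + ?t * y)"
    using ge2 by blast
  \<comment> \<open>\<open>z\<close> is forced by the recurrence
    \<open>e (k+2) = (v g + h) e (k+1) - v g h e k\<close>. The two terms \<open>g h v^(k+1)\<close>
    cancel, and the excess \<open>- t^2 v^(k+2)\<close> is the origin of the last summand.\<close>
  define z where "z = ?p * y + fps_const (1 - t\<^sup>2) * (?X * y) - ?X * (?p * x) - ?t * ?X ^ Suc (Suc k)"
  have "z \<in> homogeneous ?p (Suc (Suc k))"
    unfolding z_def
    by (intro homogeneous_diff homogeneous_add homogeneous_base_mult homogeneous_const_mult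
        homogeneous_X_mult homogeneous_X_power x)
  moreover have "?X ^ Suc (Suc k) * g ^ Suc (Suc (Suc k)) + h ^ Suc (Suc (Suc k)) =
      (?X * g + h) * (?X ^ Suc k * g ^ Suc (Suc k) + h ^ Suc (Suc k))
      - ?X * ?p * (?X ^ k * g ^ Suc k + h ^ Suc k)"
    by (simp add: algebra_simps)
  moreover have "\<dots> = (1 + ?X) * ((?X * g + h) * (?X ^ Suc k + ?t * y) - ?X * ?p * (?X ^ k + ?t * x))"
    unfolding eq by (simp add: algebra_simps)
  moreover have "?X * g + h = ?p + fps_const (1 - t\<^sup>2) * ?X"
  proof -
    have coeff: "fps_const (1 - t\<^sup>2) = 1 - ?t ^ 2" by (simp flip: fps_const_sub)
    show ?thesis
      unfolding coeff g_def h_def by (simp add: algebra_simps power2_eq_square del: fps_const_mult)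
  qed
  moreover have "(?p + fps_const (1 - t\<^sup>2) * ?X) * (?X ^ Suc k + ?t * y) - ?X * ?p * (?X ^ k + ?t * x)
      = ?X ^ Suc (Suc k) + ?t * z"
  proof -
    have coeff: "fps_const (1 - t\<^sup>2) = 1 - ?t ^ 2" by (simp flip: fps_const_sub)
    show ?thesis
      unfolding z_def coeff by (simp add: algebra_simps power2_eq_square del: fps_const_mult)
  qed
  ultimately show ?case by (intro bexI[of _ z]) simp_all
qed

section \<open>The catalytic system\<close>

lemma fps_const_dvd_iff:
  fixes c :: "'a::comm_ring_1"
  shows "fps_const c dvd f \<longleftrightarrow> (\<forall>k. c dvd f $ k)"
proof
  assume "\<forall>k. c dvd f $ k"
  then obtain q where "\<And>k. f $ k = c * q k" unfolding dvd_def by metis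
  then have "f = fps_const c * Abs_fps q" by (simp add: fps_eq_iff)
  then show "fps_const c dvd f" by simp
qed (auto simp: dvd_def)

text \<open>\<open>c\<close> is constant in the outer variable, so multiplication by
  \<open>fps_X\<close> only moves the coefficients on which divisibility is tested.\<close>

lemma fps_const_dvd_X_mult_iff:
  fixes c :: "'a::comm_ring_1"
  shows "fps_const c dvd fps_X * f \<longleftrightarrow> fps_const c dvd f"
proof
  assume "fps_const c dvd fps_X * f"
  then have "c dvd (fps_X * f) $ Suc k" for k unfolding fps_const_dvd_iff by blast
  then show "fps_const c dvd f" by (simp add: fps_const_dvd_iff)
qed simp

lemma fps_eq_0_if_X_power_dvd:
  fixes f :: "'a::comm_ring_1 fps fps"
  assumes "\<And>n. fps_const (fps_X ^ n) dvd f"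
  shows "f = 0"
proof (rule fps_ext, rule fps_ext)
  fix k n
  have "fps_X ^ Suc n dvd f $ k" using assms fps_const_dvd_iff by blast
  then obtain q where "f $ k = fps_X ^ Suc n * q" by (elim dvdE)
  then show "f $ k $ n = 0 $ k $ n" by (simp add: fps_X_power_mult_nth del: power_Suc)
qed

lemma fps_unit_mult_cancel_dvd:
  fixes c d d' x :: "'a::comm_ring_1"
  assumes "d * d' = 1" "c dvd d * x"
  shows "c dvd x"
proof -
  have "x = d' * (d * x)" using assms(1) by (simp add: mult.commute flip: mult.assoc)
  then show ?thesis using assms(2) by (metis dvd_mult)
qed

text \<open>Induction on \<open>n\<close> shows that \<open>S\<close> and \<open>T\<close> agree modulo the \<open>n\<close>-th power of the inner variable.\<close>

lemma divided_difference_system_unique: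
  fixes F G :: "nat \<Rightarrow> 'a::idom fps fps"
  assumes y: "y = fps_X * y'" "y' * y'' = 1"
    and F: "F 0 = 1" "\<And>j. y * (F (Suc j) - F j) = S * (u * F j - fps_const (F j $ 0))"
      "S = fps_const fps_X * w * F m"
    and G: "G 0 = 1" "\<And>j. y * (G (Suc j) - G j) = T * (u * G j - fps_const (G j $ 0))"
      "T = fps_const fps_X * w * G m"
  shows "S = T"
proof -
  have "fps_const (fps_X ^ n) dvd S - T" for n
  proof (induction n)
    case (Suc n)
    let ?c = "fps_const (fps_X ^ n :: 'a fps)"
    have "?c dvd F j - G j" for j
    proof (induction j)
      case (Suc j)
      then have "?c dvd fps_const (F j $ 0) - fps_const (G j $ 0)"
        by (auto simp: fps_const_dvd_iff)
      moreover have "y * (F (Suc j) - G (Suc j)) =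
          (y + S * u) * (F j - G j) + (S - T) * (u * G j - fps_const (G j $ 0))
          - S * (fps_const (F j $ 0) - fps_const (G j $ 0))"
        using F(2)[of j] G(2)[of j] by (simp add: algebra_simps del: fps_const_sub)
      ultimately have "?c dvd y * (F (Suc j) - G (Suc j))"
        using Suc \<open>?c dvd S - T\<close> by (metis dvd_add dvd_diff dvd_mult dvd_mult2)
      \<comment> \<open>\<open>y\<close> is not a unit. Its factor \<open>fps_X\<close> is cancelled
        because \<open>?c\<close> is free of the outer variable, and the cofactor \<open>y'\<close>
        is invertible.\<close>
      then have "?c dvd y' * (F (Suc j) - G (Suc j))"
        by (simp add: y(1) fps_const_dvd_X_mult_iff mult.assoc)
      then show ?case by (rule fps_unit_mult_cancel_dvd[OF y(2)])
    qed (simp add: F G)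
    \<comment> \<open>The explicit factor \<open>fps_const fps_X\<close> in the equations for
      \<open>S\<close> and \<open>T\<close> gains one power of the inner variable.\<close>
    then have "fps_const fps_X * ?c dvd fps_const fps_X * (w * (F m - G m))"
      by (intro mult_dvd_mono) auto
    then show ?case by (simp add: F(3) G(3) algebra_simps)
  qed simp
  then show ?thesis using fps_eq_0_if_X_power_dvd by (metis eq_iff_diff_eq_0)
qed

lemma fps_unit_if_nth_0_eq_1:
  fixes f :: "'a::comm_ring_1 fps"
  assumes "f $ 0 = 1"
  shows "\<exists>f'. f * f' = 1"
  using fps_right_inverse[of f 1] assms by auto

text \<open>The outer variable of \<open>F j\<close> is \<open>u - 1\<close>, so that \<open>(u F - F(1)) / (u - 1)\<close> is \<open>F + fps_shift 1 F\<close>; the inner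
  variable is \<open>x\<close>. In the proof, the explicit candidate \<open>S\<close> for \<open>T\<close> solves the system in terms of \<open>v\<close>: the
  forest series \<open>G\<close> built from \<open>S\<close> satisfies \<open>G (r + 1) = H\<close>, since multiplied by \<open>v ^ (r + 1)\<close> both are
  \<open>a ^ (r + 1)\<close> up to \<open>b\<close> times a form of degree \<open>r\<close> in \<open>v\<close> and \<open>a\<close>, and a nonzero such form has order at
  most \<open>r\<close> in \<open>v\<close>.\<close>

lemma catalytic_system_at_1:
  fixes F :: "nat \<Rightarrow> real fps fps" and t :: "real fps"
  assumes t: "t * (1 - t) ^ (2 * r) = fps_X" "t $ 0 = 0"
    and F0: "F 0 = 1"
    and FS: "\<And>j. F (Suc j) = F j + T * (F j + fps_shift 1 (F j))"
    and T: "T = fps_const fps_X * (1 + fps_X) * F (Suc r)"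
  shows "T $ 0 * (1 - t)\<^sup>2 = t * (1 - of_nat (Suc r) * t)"
proof -
  let ?v = "fps_X :: real fps fps" and ?t = "fps_const t"
  define g where "g = 1 + ?t * ?v"
  define h where "h = ?v + ?t"
  \<comment> \<open>\<open>D\<close> is \<open>(u - 1) g^(r+1) / v\<close> for the \<open>u\<close>
    defined below. Its value \<open>1 - (r+1) t\<close> at \<open>v = 0\<close> is the source of the
    numerator in the conclusion.\<close>
  define D where "D = fps_shift 1 (1 + ?v - g ^ Suc r)"
  have t0: "t \<noteq> 0" using t(1) by (metis fps_X_neq_zero mult_zero_left)
  \<comment> \<open>\<open>s\<close> is \<open>1 / (1 - t)^2\<close>; with this factor
    \<open>v + s t (1 + v)^2\<close> splits as \<open>s g h\<close>.\<close>
  obtain s where "(1 - t)\<^sup>2 * s = 1"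
    using fps_unit_if_nth_0_eq_1[of "(1 - t)\<^sup>2"] t(2) by (auto simp: fps_nth_power_0)
  moreover have "(1 - ?t)\<^sup>2 * fps_const s = fps_const ((1 - t)\<^sup>2 * s)"
    by (simp flip: fps_const_mult fps_const_sub fps_const_power)
  ultimately have s: "?v * ((1 - ?t)\<^sup>2 * fps_const s) = ?v" "(1 - ?t)\<^sup>2 * fps_const s = 1"
    and s0: "s \<noteq> 0"
    by auto
  have g0: "g ^ n $ 0 = 1" for n by (simp add: g_def fps_nth_power_0)
  obtain gi where gi: "g ^ Suc r * gi = 1"
    using fps_unit_if_nth_0_eq_1[OF g0] by blast
  have vD: "?v * D = 1 + ?v - g ^ Suc r"
    using g0[of "Suc r"] unfolding D_def
    by (intro fps_ext) (auto simp: fps_X_mult_nth simp del: power_Suc)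
  have g1: "g ^ n $ 1 = of_nat n * t" for n
    by (induction n) (auto simp: g_def fps_mult_nth_1 fps_nth_power_0 algebra_simps)
  have D0: "D $ 0 = 1 - of_nat (Suc r) * t"
    unfolding D_def using g1[of "Suc r"] by (simp del: power_Suc of_nat_Suc)
  define u where "u = (1 + ?v) * gi"
  define y where "y = u - 1"
  have ug: "u * g ^ Suc r = 1 + ?v"
    unfolding u_def using gi by (metis mult.assoc mult.commute mult.right_neutral)
  have yg: "y * g ^ Suc r = ?v * D"
    unfolding y_def vD by (simp add: left_diff_distrib ug del: power_Suc)
  have y: "y = ?v * (D * gi)"
    using yg gi by (metis mult.assoc mult.right_neutral)
  obtain Di where Di: "D * Di = 1"
  proof -
    have "D $ 0 $ 0 = 1" by (simp add: D0 t(2) del: of_nat_Suc)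
    then obtain d where "D $ 0 * d = 1" using fps_unit_if_nth_0_eq_1 by blast
    then show ?thesis using fps_right_inverse that by blast
  qed
  have y': "(D * gi) * (g ^ Suc r * Di) = 1"
    using gi Di by (metis (no_types, lifting) mult.assoc mult.commute mult.right_neutral)
  \<comment> \<open>With \<open>S\<close> as below, \<open>a / v\<close> is
    \<open>A = 1 + S u / y\<close> and \<open>b / v\<close> is \<open>S / y\<close>. The system
    thereby becomes \<open>v G (j+1) = a G j - b c\<close>, where \<open>c\<close> is the constant
    term of \<open>G j\<close>.\<close>
  define a where "a = fps_const s * (g * h)"
  define b where "b = fps_const s * ?t * (1 + ?v) * g ^ Suc r"
  define S where "S = fps_const s * ?t * (1 + ?v) * D"
  have vS: "?v * S = b * y"
    unfolding S_def b_def by (simp add: yg mult.assoc del: power_Suc) (simp add: yg mult_ac del: power_Suc)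
  have bu: "b * u = fps_const s * ?t * (1 + ?v)\<^sup>2"
    unfolding b_def by (simp add: ug power2_eq_square mult_ac del: power_Suc)
  have a_eq: "?v + fps_const s * ?t * (1 + ?v)\<^sup>2 = a"
  proof -
    have expand: "x * ((1 - d)\<^sup>2 * e) + e * d * (1 + x)\<^sup>2 = e * ((1 + d * x) * (x + d))"
      for x d e :: "real fps fps"
      by (simp add: algebra_simps power2_eq_square)
    have "?v + fps_const s * ?t * (1 + ?v)\<^sup>2
        = ?v * ((1 - ?t)\<^sup>2 * fps_const s) + fps_const s * ?t * (1 + ?v)\<^sup>2"
      unfolding s(1) ..
    also have "\<dots> = a"
      unfolding a_def g_def h_def by (rule expand)
    finally show ?thesis .
  qed
  have ay: "?v * (y + S * u) = a * y"
  proof -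
    have "?v * (y + S * u) = ?v * y + (?v * S) * u" by (simp add: algebra_simps)
    also have "\<dots> = (?v + b * u) * y" unfolding vS by (simp add: algebra_simps)
    finally show ?thesis unfolding bu a_eq .
  qed
  have ab0: "a $ 0 = s * t" "b $ 0 = s * t"
    unfolding a_def b_def by (simp_all add: g0 h_def g_def fps_nth_power_0)
  \<comment> \<open>The shift is a true division by \<open>v\<close>: the dropped constant term
    vanishes because \<open>a\<close> and \<open>b\<close> both start with
    \<open>s * t\<close>.\<close>
  define G where "G = rec_nat 1 (\<lambda>j x. fps_shift 1 (a * x - fps_const (x $ 0) * b))"
  have G0: "G 0 = 1" and GS: "?v * G (Suc j) = a * G j - fps_const (G j $ 0) * b" for j
    by (simp add: G_def) (intro fps_ext, simp add: G_def fps_X_mult_nth ab0 mult.commute)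
  have "y * (G (Suc j) - G j) = S * (u * G j - fps_const (G j $ 0))" for j
  proof -
    have "?v * (y * (G (Suc j) - G j)) = y * (?v * G (Suc j)) - ?v * y * G j"
      by (simp add: algebra_simps)
    also have "\<dots> = (a * y) * G j - fps_const (G j $ 0) * (b * y) - ?v * y * G j"
      unfolding GS by (simp add: algebra_simps)
    also have "\<dots> = ?v * (S * (u * G j - fps_const (G j $ 0)))"
      unfolding ay [symmetric] vS [symmetric] by (simp add: algebra_simps)
    finally show ?thesis by simp
  qed
  note Gsystem = G0 this
  have "\<exists>x \<in> homogeneous a j. ?v ^ Suc j * G (Suc j) = a ^ Suc j - b * x" for j
  proof (induction j)
    case 0
    have "1 \<in> homogeneous a 0" using homogeneous_X_power[of 0] by simp
    then show ?case using GS[of 0] by (intro bexI[of _ 1]) (simp_all add: G0)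
  next
    case (Suc j)
    then obtain x where x: "x \<in> homogeneous a j" "?v ^ Suc j * G (Suc j) = a ^ Suc j - b * x" by blast
    have "?v ^ Suc (Suc j) * G (Suc (Suc j)) = ?v ^ Suc j * (?v * G (Suc (Suc j)))" by (simp add: mult_ac)
    also have "\<dots> = a * (?v ^ Suc j * G (Suc j)) - b * (fps_const (G (Suc j) $ 0) * ?v ^ Suc j)"
      unfolding GS by (simp add: algebra_simps)
    also have "\<dots> = a ^ Suc (Suc j) - b * (a * x + fps_const (G (Suc j) $ 0) * ?v ^ Suc j)"
      unfolding x(2) by (simp add: algebra_simps)
    finally show ?case
      using homogeneous_add[OF homogeneous_base_mult[OF x(1)]
          homogeneous_const_mult[OF homogeneous_X_power[of "Suc j"]]] by blast
  qed
  then obtain x1 where x1: "x1 \<in> homogeneous a r" "?v ^ Suc r * G (Suc r) = a ^ Suc r - b * x1" by blast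
  \<comment> \<open>\<open>H\<close> is \<open>S / (x u)\<close>, the value that
    \<open>G (r + 1)\<close> must have for \<open>S\<close> to satisfy the last equation of the
    system.\<close>
  define H where "H = fps_const s ^ Suc r * D * g ^ Suc r"
  obtain x2 where x2: "x2 \<in> homogeneous (g * h) r"
    "?v ^ r * g ^ Suc r + h ^ Suc r = (1 + ?v) * (?v ^ r + ?t * x2)"
    using kernel_identity[of t r] unfolding g_def h_def by blast
  have x2': "fps_const s ^ r * x2 \<in> homogeneous a r"
    unfolding a_def by (rule homogeneous_scale[OF x2(1)])
  have "?v ^ Suc r * H = fps_const s ^ Suc r * g ^ Suc r * (?v ^ r * (?v * D))"
    unfolding H_def by (simp add: mult_ac)
  also have "\<dots> = fps_const s ^ Suc r * g ^ Suc r *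
      (h ^ Suc r - ?t * (1 + ?v) * x2)"
  proof -
    have "?v ^ r * (1 + ?v - g ^ Suc r) = h ^ Suc r - ?t * (1 + ?v) * x2"
      using x2(2) by (simp add: algebra_simps)
    then show ?thesis unfolding vD by simp
  qed
  also have "\<dots> = a ^ Suc r - b * (fps_const s ^ r * x2)"
    unfolding a_def b_def by (simp add: algebra_simps power_mult_distrib)
  finally have "?v ^ Suc r * (G (Suc r) - H) = b * (fps_const s ^ r * x2 - x1)"
    using x1(2) by (simp add: algebra_simps)
  then have "G (Suc r) - H = 0"
    using ab0 t0 s0 x1(1) x2'
    by (intro homogeneous_divisible_eq_0[of a b "fps_const s ^ r * x2 - x1" r] homogeneous_diff) auto
  then have GH: "G (Suc r) = H" by simp
  have SG: "S = fps_const fps_X * u * G (Suc r)"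
  proof -
    have X: "fps_const fps_X = ?t * (1 - ?t) ^ (2 * r)"
      unfolding t(1) [symmetric] by (simp flip: fps_const_mult fps_const_power fps_const_sub)
    have "fps_const fps_X * u * G (Suc r) =
        ?t * (u * g ^ Suc r) * D * fps_const s * ((1 - ?t) ^ 2 * fps_const s) ^ r"
      unfolding X GH H_def power_mult
      by (simp add: power_mult_distrib mult_ac del: fps_const_mult fps_const_power)
    also have "\<dots> = S" unfolding ug s(2) S_def by (simp add: mult_ac)
    finally show ?thesis by simp
  qed
  have y0: "y $ 0 = 0" by (simp add: y)
  \<comment> \<open>Substituting \<open>y = u - 1\<close> for the outer variable expresses the given
    system in terms of \<open>v\<close>. As \<open>y\<close> vanishes at \<open>v = 0\<close>,
    constant terms, the values at \<open>u = 1\<close>, are preserved.\<close>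
  define K where "K j = F j oo y" for j
  have "y * (K (Suc j) - K j) = (T oo y) * (u * K j - fps_const (K j $ 0))" for j
  proof -
    have "?v * fps_shift 1 (F j) = F j - fps_const (F j $ 0)"
      by (intro fps_ext) (auto simp: fps_X_mult_nth)
    then have "(?v * fps_shift 1 (F j)) oo y = (F j - fps_const (F j $ 0)) oo y" by simp
    then have "y * (fps_shift 1 (F j) oo y) = K j - fps_const (F j $ 0)"
      by (simp add: K_def fps_compose_mult_distrib[OF y0] fps_compose_sub_distrib fps_X_fps_compose_startby0[OF y0])
    moreover have "K (Suc j) - K j = (T oo y) * (K j + (fps_shift 1 (F j) oo y))"
      unfolding K_def FS[of j] fps_compose_add_distrib fps_compose_mult_distrib[OF y0] by simp
    then have "y * (K (Suc j) - K j) = (T oo y) * (y * K j + y * (fps_shift 1 (F j) oo y))"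
      by (simp add: algebra_simps)
    moreover have "u * K j - fps_const (K j $ 0) = y * K j + (K j - fps_const (F j $ 0))"
      by (simp add: K_def y_def algebra_simps)
    ultimately show ?thesis by simp
  qed
  moreover have "T oo y = fps_const fps_X * u * K (Suc r)"
    unfolding T K_def
    by (simp add: fps_compose_mult_distrib[OF y0] fps_compose_add_distrib
        fps_X_fps_compose_startby0[OF y0]) (simp add: y_def)
  moreover have "K 0 = 1" by (simp add: K_def F0)
  ultimately have "T oo y = S"
    using divided_difference_system_unique[OF y y', of K "T oo y" u u "Suc r" G S] Gsystem SG by blast
  then have "T $ 0 = S $ 0" by (metis fps_compose_nth_0)
  then have "T $ 0 = s * t * (1 - of_nat (Suc r) * t)"
    by (simp add: S_def D0 del: of_nat_Suc)
  moreover have "s * (1 - t)\<^sup>2 = 1" using \<open>(1 - t)\<^sup>2 * s = 1\<close> by (simp add: mult.commute)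
  ultimately show ?thesis by (metis (no_types, opaque_lifting) mult.assoc mult.commute mult.right_neutral)
qed

section \<open>Lagrange inversion\<close>

text \<open>\<open>q ^ i\<close> has order at least \<open>i\<close>, so only the powers up to
  \<open>n\<close> reach the coefficient of degree \<open>n\<close>.\<close>

lemma fps_compose_mult_nth:
  fixes a q b :: "'a::comm_ring_1 fps"
  assumes "q $ 0 = 0"
  shows "((a oo q) * b) $ n = (\<Sum>i\<le>n. a $ i * (q ^ i * b) $ n)"
proof -
  have "(a oo q) $ j = (\<Sum>i\<le>n. a $ i * q ^ i $ j)" if "j \<le> n" for j
    unfolding fps_compose_nth using that startsby_zero_power_prefix[OF assms]
    by (intro sum.mono_neutral_left) auto
  then have "((a oo q) * b) $ n = (\<Sum>j\<le>n. (\<Sum>i\<le>n. a $ i * q ^ i $ j) * b $ (n - j))"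
    by (simp add: fps_mult_nth atLeast0AtMost)
  also have "\<dots> = (\<Sum>j\<le>n. \<Sum>i\<le>n. a $ i * (q ^ i $ j * b $ (n - j)))"
    by (simp add: sum_distrib_right mult.assoc)
  also have "\<dots> = (\<Sum>i\<le>n. a $ i * (q ^ i * b) $ n)"
    by (subst sum.swap) (simp add: fps_mult_nth atLeast0AtMost sum_distrib_left)
  finally show ?thesis .
qed

text \<open>With \<open>q = X w\<close>, the right side is the residue of
  \<open>(M oo q)' / q^(n+1)\<close>. Expanding in powers of \<open>q\<close> leaves the residues of
  \<open>q^(i-n-1) q'\<close>: these are 0 for \<open>i < n\<close>, where the term is an exact
  derivative, and 1 for \<open>i = n\<close>.\<close>

lemma lagrange_inversion:
  fixes M w :: "'a::field_char_0 fps"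
  assumes w: "w $ 0 = 1"
  shows "of_nat (Suc n) * M $ Suc n = (fps_deriv (M oo fps_X * w) * inverse w ^ Suc n) $ n"
proof -
  let ?q = "fps_X * w" and ?V = "inverse w"
  have wV: "w * ?V = 1" using w by (simp add: inverse_mult_eq_1')
  have dV: "w * fps_deriv ?V = - fps_deriv w * ?V"
    using w wV by (simp add: fps_inverse_deriv power2_eq_square)
  have summand: "(?q ^ i * (fps_deriv ?q * ?V ^ Suc n)) $ n = (if i = n then 1 else 0)" if "i \<le> n" for i
  proof -
    define j where "j = n - i"
    have n: "n = i + j" using that by (simp add: j_def)
    have wVi: "w ^ i * ?V ^ i = 1" by (metis wV power_mult_distrib power_one)
    have "?q ^ i * (d * ?V ^ Suc n) = fps_X ^ i * (w ^ i * ?V ^ i) * (d * ?V ^ Suc j)" for d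
      unfolding n power_mult_distrib power_add power_Suc by (simp only: mult_ac)
    then have shift: "?q ^ i * (fps_deriv ?q * ?V ^ Suc n) = fps_X ^ i * (fps_deriv ?q * ?V ^ Suc j)"
      by (simp only: wVi mult_1_right)
    have "(?q ^ i * (fps_deriv ?q * ?V ^ Suc n)) $ n = (fps_deriv ?q * ?V ^ Suc j) $ j"
      unfolding shift by (simp add: n fps_X_power_mult_nth del: power_Suc)
    also have "fps_deriv ?q * ?V ^ Suc j = ?V ^ j * (w * ?V) + fps_X * (fps_deriv w * ?V * ?V ^ j)"
      by (simp add: algebra_simps)
    also have "\<dots> = ?V ^ j - fps_X * (w * (?V ^ j * fps_deriv ?V))"
    proof -
      have "fps_deriv w * ?V * ?V ^ j = - (?V ^ j * (w * fps_deriv ?V))"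
        unfolding dV by (simp only: mult_minus_left mult_minus_right minus_minus mult_ac)
      then show ?thesis by (simp only: wV mult_1_right mult_minus_right mult_ac) simp
    qed
    finally have eq: "(?q ^ i * (fps_deriv ?q * ?V ^ Suc n)) $ n
      = (?V ^ j - fps_X * (w * (?V ^ j * fps_deriv ?V))) $ j" .
    show ?thesis
    proof (cases j)
      case 0
      then show ?thesis unfolding eq using n by simp
    next
      case (Suc l)
      \<comment> \<open>Since \<open>w V = 1\<close>, the series \<open>w V^j V'\<close> is the
        derivative of \<open>V^j\<close> divided by \<open>j\<close>. Its coefficient at
        \<open>j - 1\<close> is therefore that of \<open>V^j\<close> at \<open>j\<close>, and the
        two terms cancel.\<close>
      have "fps_deriv (?V ^ j) = of_nat j * (?V ^ l * fps_deriv ?V)"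
        by (simp only: fps_deriv_power Suc diff_Suc_1 mult_ac fps_of_nat)
      then have "of_nat j * (w * (?V ^ j * fps_deriv ?V)) = (w * ?V) * fps_deriv (?V ^ j)"
        by (simp only: Suc power_Suc mult_ac)
      then have "of_nat j * (w * (?V ^ j * fps_deriv ?V)) = fps_deriv (?V ^ j)"
        by (simp only: wV mult_1_left)
      then have "(of_nat j * (w * (?V ^ j * fps_deriv ?V))) $ l = of_nat j * ?V ^ j $ j"
        by (simp only: fps_deriv_nth Suc Suc_eq_plus1)
      then have "of_nat j * (w * (?V ^ j * fps_deriv ?V)) $ l = of_nat j * ?V ^ j $ j"
        by (simp only: fps_mult_of_nat_nth)
      moreover have "of_nat j \<noteq> (0 :: 'a)" using Suc by (simp del: of_nat_Suc)
      ultimately have "(w * (?V ^ j * fps_deriv ?V)) $ l = ?V ^ j $ j"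
        by (simp only: mult_cancel_left) simp
      moreover have "i \<noteq> n" "j \<noteq> 0" "j - 1 = l" using n Suc by simp_all
      ultimately show ?thesis unfolding eq by (simp only: fps_sub_nth fps_X_mult_nth if_False) simp
    qed
  qed
  have "(fps_deriv (M oo ?q) * ?V ^ Suc n) $ n = ((fps_deriv M oo ?q) * (fps_deriv ?q * ?V ^ Suc n)) $ n"
    by (subst fps_compose_deriv) (simp_all add: mult.assoc)
  also have "\<dots> = (\<Sum>i\<le>n. fps_deriv M $ i * (?q ^ i * (fps_deriv ?q * ?V ^ Suc n)) $ n)"
    by (rule fps_compose_mult_nth) simp
  also have "\<dots> = (\<Sum>i\<le>n. fps_deriv M $ i * (if i = n then 1 else 0))"
    by (intro sum.cong refl arg_cong2[where f = times] summand) simp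
  also have "\<dots> = of_nat (Suc n) * M $ Suc n" by (simp add: mult_delta_right)
  finally show ?thesis ..
qed

text \<open>The derivative of \<open>h\<close> is \<open>(1 - (2r+1) X) / (1 - X)^3\<close>, so
  Lagrange inversion gives \<open>n M_n\<close> as a combination of two coefficients of one negative
  power of \<open>1 - X\<close>, hence of two binomial coefficients.\<close>

lemma coefficient_of_parametrized_series:
  fixes M :: "real fps"
  assumes "M oo fps_X * (1 - fps_X) ^ (2 * r) = h"
    and h: "h * (1 - fps_X)\<^sup>2 = fps_X * (1 - of_nat (Suc r) * fps_X)"
    and n: "n \<ge> 1"
  shows "M $ n = 2 * (real r + 1) * fact ((2 * r + 1) * n) / (fact n * fact (2 * r * n + 2))"
proof -
  let ?X = "fps_X :: real fps"
  let ?J = "inverse (1 - ?X)" and ?c = "of_nat (Suc r) :: real fps"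
  have J: "(1 - ?X) * ?J = 1" by (simp add: inverse_mult_eq_1')
  have dJ: "fps_deriv ?J = ?J\<^sup>2" by (simp add: fps_inverse_deriv)
  have "(1 - ?X)\<^sup>2 * ?J\<^sup>2 = 1" by (metis J power_mult_distrib power_one)
  then have "h = h * (1 - ?X)\<^sup>2 * ?J\<^sup>2" by (simp add: mult.assoc)
  then have h': "h = ?X * (1 - ?c * ?X) * ?J\<^sup>2" using h by simp
  have collect: "a * y\<^sup>2 * (b * y) + c * y ^ 3 = (a * b + c) * y ^ 3" for a b c y :: "real fps"
    by (simp add: power2_eq_square power3_eq_cube algebra_simps)
  have "fps_deriv h = (1 - 2 * ?c * ?X) * ?J\<^sup>2 * 1 + 2 * (?X * (1 - ?c * ?X)) * ?J ^ 3"
    unfolding h' by (simp add: dJ fps_deriv_power power2_eq_square power3_eq_cube algebra_simps del: of_nat_Suc)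
  also have "\<dots> = (1 - 2 * ?c * ?X) * ?J\<^sup>2 * ((1 - ?X) * ?J) + 2 * (?X * (1 - ?c * ?X)) * ?J ^ 3"
    by (simp only: J)
  also have "\<dots> = ((1 - 2 * ?c * ?X) * (1 - ?X) + 2 * (?X * (1 - ?c * ?X))) * ?J ^ 3"
    by (rule collect)
  also have "(1 - 2 * ?c * ?X) * (1 - ?X) + 2 * (?X * (1 - ?c * ?X)) = 1 - of_nat (2 * r + 1) * ?X"
    by (simp add: algebra_simps)
  finally have dh: "fps_deriv h = (1 - of_nat (2 * r + 1) * ?X) * ?J ^ 3" .
  obtain m where m: "n = Suc m" using n by (cases n) auto
  have Jnth: "?J ^ Suc k $ l = real ((k + l) choose l)" for k l
    using arg_cong[OF one_minus_const_fps_X_neg_power'[of "Suc k" "1::real"], of "\<lambda>f. f $ l"]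
    by (simp add: fps_inverse_power del: power_Suc)
  define K where "K = 2 * r * n + 2"
  have "real n * M $ n = (fps_deriv h * inverse ((1 - ?X) ^ (2 * r)) ^ n) $ m"
    using lagrange_inversion[of "(1 - ?X) ^ (2 * r)" m M] assms(1) by (simp add: m fps_nth_power_0)
  also have "fps_deriv h * inverse ((1 - ?X) ^ (2 * r)) ^ n
      = (1 - of_nat (2 * r + 1) * ?X) * ?J ^ Suc (2 * r * n + 2)"
  proof -
    have "inverse ((1 - ?X) ^ (2 * r)) ^ n = ?J ^ (2 * r * n)"
      by (simp only: fps_inverse_power power_mult)
    moreover have "Suc (2 * r * n + 2) = 3 + 2 * r * n" by simp
    ultimately show ?thesis unfolding dh by (simp only: power_add mult.assoc)
  qed
  also have "\<dots> $ m = ?J ^ Suc (2 * r * n + 2) $ m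
      - real (2 * r + 1) * (?X * ?J ^ Suc (2 * r * n + 2)) $ m"
    by (simp add: left_diff_distrib mult.assoc fps_mult_of_nat_nth del: power_Suc of_nat_add of_nat_Suc of_nat_mult)
  finally have nM: "real n * M $ n = ?J ^ Suc K $ m - real (2 * r + 1) * (?X * ?J ^ Suc K) $ m"
    unfolding K_def .
  define N where "N = (2 * r + 1) * n"
  have N: "Suc N = K + m" unfolding N_def K_def m by (simp add: distrib_right)
  have "real n * M $ n = (2 * real r + 2) * fact N / (fact m * fact K)"
  proof (cases m)
    case 0
    then have "K = Suc N" using N by simp
    then have K: "fact K = real K * fact N" by (simp only: fact_Suc)
    have "real K = 2 * real r + 2" using 0 by (simp add: K_def m)
    then show ?thesis
      using nM 0 unfolding K by (simp add: Jnth del: power_Suc)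
  next
    case (Suc l)
    then have N': "N = K + l" using N by simp
    have "real n * M $ n = real ((K + m) choose m) - real (2 * r + 1) * real ((K + l) choose l)"
      unfolding nM Jnth using Suc by (simp add: fps_X_mult_nth Jnth del: power_Suc)
    also have "real ((K + m) choose m) = fact (Suc N) / (fact m * fact K)"
      using binomial_fact[of m "K + m", where ?'a = real] by (simp only: N) simp
    also have "real ((K + l) choose l) = fact N / (fact l * fact K)"
      using binomial_fact[of l "K + l", where ?'a = real] by (simp only: N') simp
    also have "\<dots> = real m * fact N / (fact m * fact K)"
      unfolding Suc by simp
    also have "fact (Suc N) / (fact m * fact K) - real (2 * r + 1) * (real m * fact N / (fact m * fact K))
        = (real (Suc N) - real (2 * r + 1) * real m) * fact N / (fact m * fact K)"
      unfolding fact_Suc by (simp only: diff_divide_distrib left_diff_distrib times_divide_eq_right mult.assoc)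
    \<comment> \<open>Because \<open>n - m = 1\<close>, the difference is
      \<open>(2r+1) + 1\<close>.\<close>
    also have "real (Suc N) - real (2 * r + 1) * real m = 2 * real r + 2"
      unfolding N_def m by (simp add: algebra_simps)
    finally show ?thesis .
  qed
  then have "M $ n = (2 * real r + 2) * fact N / (real n * fact m * fact K)"
    using n by (simp add: field_simps)
  also have "real n * fact m = fact n" unfolding m by simp
  finally show ?thesis by (simp add: N_def K_def)
qed

text \<open>The parameter \<open>t\<close> is the compositional inverse of
  \<open>q = X (1 - X)^(2r)\<close>. Composing the closed form in \<open>t\<close> with
  \<open>q\<close> replaces \<open>t\<close> by the variable, which is the shape needed for
  coefficient extraction.\<close>

lemma catalytic_coefficient:
  fixes F :: "nat \<Rightarrow> real fps fps"
  assumes F0: "F 0 = 1"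
    and FS: "\<And>j. F (Suc j) = F j + T * (F j + fps_shift 1 (F j))"
    and T: "T = fps_const fps_X * (1 + fps_X) * F (Suc r)"
    and n: "n \<ge> 1"
  shows "T $ 0 $ n = 2 * (real r + 1) * fact ((2 * r + 1) * n) / (fact n * fact (2 * r * n + 2))"
proof -
  define q where "q = fps_X * (1 - fps_X :: real fps) ^ (2 * r)"
  have q: "q $ 0 = 0" "q $ 1 \<noteq> 0" by (simp_all add: q_def fps_X_mult_nth fps_nth_power_0)
  define t where "t = fps_inv q"
  have t0: "t $ 0 = 0" by (simp add: t_def fps_inv_def)
  have "q oo t = fps_X" unfolding t_def by (rule fps_inv_right[OF q])
  moreover have "q oo t = t * (1 - t) ^ (2 * r)"
    by (simp add: q_def fps_compose_mult_distrib[OF t0] fps_compose_power[OF t0, symmetric]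
        fps_compose_sub_distrib fps_X_fps_compose_startby0[OF t0])
  ultimately have t: "t * (1 - t) ^ (2 * r) = fps_X" by simp
  have "T $ 0 * (1 - t)\<^sup>2 = t * (1 - of_nat (Suc r) * t)"
    by (rule catalytic_system_at_1[OF t t0 F0 FS T])
  then have "(T $ 0 * (1 - t)\<^sup>2) oo q = (t * (1 - of_nat (Suc r) * t)) oo q" by simp
  moreover have "t oo q = fps_X" unfolding t_def by (rule fps_inv[OF q])
  ultimately have "(T $ 0 oo q) * (1 - fps_X)\<^sup>2 = fps_X * (1 - of_nat (Suc r) * fps_X)"
    by (simp add: fps_compose_mult_distrib[OF q(1)] fps_compose_power[OF q(1), symmetric]
        fps_compose_sub_distrib flip: fps_of_nat del: of_nat_Suc)
  then show ?thesis using n unfolding q_def by (intro coefficient_of_parametrized_series[OF refl])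
qed

section \<open>Words as forests\<close>

definition nested :: "nat list \<Rightarrow> bool" where
  "nested w \<longleftrightarrow> (\<forall>i j k. i < j \<and> j < k \<and> k < length w \<and> w ! i = w ! k \<longrightarrow> w ! j \<le> w ! i)"

text \<open>An r-permutation of the set of its own letters. Leaving the alphabet open suits the
  recursion into blocks.\<close>

definition rperm :: "nat \<Rightarrow> nat list \<Rightarrow> bool" where
  "rperm r w \<longleftrightarrow> (\<forall>a\<in>set w. count_list w a = r) \<and> nested w"

lemma r_permutation_iff:
  assumes "r \<ge> 1"
  shows "r_permutation r A w \<longleftrightarrow> set w = A \<and> rperm r w"
proof -
  have "a \<in> set w" if "count_list w a = r" for a
    using that assms by (metis count_notin not_one_le_zero)
  then show ?thesis by (auto simp: r_permutation_def rperm_def nested_def)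
qed

lemma rperm_Nil [simp]: "rperm r []"
  by (simp add: rperm_def nested_def)

text \<open>A letter common to \<open>u\<close> and \<open>w\<close> would enclose the larger letter
  \<open>m\<close>. Conversely, a pair of equal letters then lies inside \<open>u\<close>, inside
  \<open>m # w\<close> starting with \<open>m\<close>, or inside \<open>w\<close>.\<close>

lemma nested_append_Cons:
  assumes u: "\<And>x. x \<in> set u \<Longrightarrow> x < m" and w: "\<And>x. x \<in> set w \<Longrightarrow> x \<le> m"
  shows "nested (u @ m # w) \<longleftrightarrow> nested u \<and> nested w \<and> set u \<inter> set w = {}" (is "?l \<longleftrightarrow> ?r")
proof
  assume l: ?l
  have "nested u" unfolding nested_def
  proof (intro allI impI, elim conjE)
    fix i j k assume "i < j" "j < k" "k < length u" "u ! i = u ! k"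
    then show "u ! j \<le> u ! i"
      using l[unfolded nested_def, rule_format, of i j k] by (simp add: nth_append)
  qed
  moreover have "nested w" unfolding nested_def
  proof (intro allI impI, elim conjE)
    fix i j k assume "i < j" "j < k" "k < length w" "w ! i = w ! k"
    then show "w ! j \<le> w ! i"
      using l[unfolded nested_def, rule_format,
          of "length u + Suc i" "length u + Suc j" "length u + Suc k"]
      by (simp add: nth_append)
  qed
  moreover have "set u \<inter> set w = {}"
  proof (rule ccontr)
    assume "set u \<inter> set w \<noteq> {}"
    then obtain a where "a \<in> set u" "a \<in> set w" by blast
    then obtain i k where "i < length u" "k < length w" "u ! i = w ! k"
      by (metis in_set_conv_nth)
    then have "m \<le> u ! i"
      using l[unfolded nested_def, rule_format, of i "length u" "length u + Suc k"]
      by (simp add: nth_append)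
    with \<open>i < length u\<close> u show False by (meson nth_mem not_le)
  qed
  ultimately show ?r by blast
next
  assume r: ?r
  show ?l unfolding nested_def
  proof (intro allI impI, elim conjE)
    fix i j k
    assume ijk: "i < j" "j < k" "k < length (u @ m # w)"
      and eq: "(u @ m # w) ! i = (u @ m # w) ! k"
    consider "k < length u" | "k = length u" | "k > length u" "i < length u"
      | "k > length u" "i = length u" | "k > length u" "i > length u" by linarith
    then show "(u @ m # w) ! j \<le> (u @ m # w) ! i"
    proof cases
      case 1
      then show ?thesis
        using r ijk eq unfolding nested_def by (auto simp: nth_append)
    next
      case 2
      then have "u ! i = m" "i < length u" using ijk eq by (auto simp: nth_append)
      then show ?thesis using u by (metis nat_neq_iff nth_mem)
    next
      case 3
      then have "u ! i = w ! (k - Suc (length u))" "k - Suc (length u) < length w"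
        using ijk eq by (auto simp: nth_append nth_Cons')
      then show ?thesis using r 3 by (metis IntI empty_iff nth_mem)
    next
      case 4
      then have "j - Suc (length u) < length w" "(u @ m # w) ! j = w ! (j - Suc (length u))"
        using ijk by (auto simp: nth_append nth_Cons')
      then show ?thesis using 4 w by (simp add: nth_append)
    next
      case 5
      define i' j' k' where "i' = i - Suc (length u)" "j' = j - Suc (length u)" "k' = k - Suc (length u)"
      note defs = this
      have *: "i = length u + Suc i'" "j = length u + Suc j'" "k = length u + Suc k'"
        using ijk 5 by (auto simp: defs)
      have "w ! i' = w ! k'" using eq unfolding * by (simp add: nth_append)
      then have "w ! j' \<le> w ! i'"
        using r ijk unfolding nested_def * by auto
      then show ?thesis unfolding * by (simp add: nth_append)
    qed
  qed
qed

section \<open>Cutting words at their largest letter and joining blocks again\<close>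

fun unblocks :: "'a \<Rightarrow> 'a list list \<Rightarrow> 'a list" where
  "unblocks m [] = []"
| "unblocks m [b] = b"
| "unblocks m (b # c # bs) = b @ m # unblocks m (c # bs)"

lemma unblocks_Cons_hd: "bs \<noteq> [] \<Longrightarrow> unblocks m ((x # hd bs) # tl bs) = x # unblocks m bs"
  \<comment> \<open>This case rule distinguishes empty, singleton and longer lists, as the equations
    of \<open>unblocks\<close> do.\<close>
  by (cases bs rule: remdups_adj.cases) auto

lemma unblocks_blocks: "unblocks m (blocks m w) = w"
proof (induction w)
  case (Cons x w)
  show ?case
  proof (cases "x = m")
    case True
    obtain b bs where "blocks m w = b # bs" by (meson blocks_nonempty neq_Nil_conv)
    then show ?thesis using Cons True by simp
  qed (simp add: unblocks_Cons_hd Cons)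
qed simp

lemma blocks_unblocks:
  "bs \<noteq> [] \<Longrightarrow> m \<notin> \<Union>(set ` set bs) \<Longrightarrow> blocks m (unblocks m bs) = bs"
  by (induction m bs rule: unblocks.induct) (auto simp: blocks_not_in blocks_append)

lemma set_unblocks: "set (unblocks m bs) = \<Union>(set ` set bs) \<union> (if length bs \<ge> 2 then {m} else {})"
  by (induction m bs rule: unblocks.induct) auto

lemma set_block_subset: "b \<in> set (blocks m w) \<Longrightarrow> set b \<subseteq> set w - {m}"
proof (induction w arbitrary: b)
  case (Cons x w)
  obtain c cs where c: "blocks m w = c # cs" by (meson blocks_nonempty neq_Nil_conv)
  have "set c \<subseteq> set w - {m}" "\<forall>d\<in>set cs. set d \<subseteq> set w - {m}" using Cons.IH by (simp_all add: c)
  then show ?case using Cons.prems by (auto simp: c split: if_splits)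
qed simp

text \<open>Iterates \<open>nested_append_Cons\<close> from the left. \<open>sorted_wrt\<close>
  expresses disjointness for pairs of positions, so a block that occurs twice has to be
  empty.\<close>

lemma nested_unblocks_iff:
  assumes "\<And>b x. b \<in> set bs \<Longrightarrow> x \<in> set b \<Longrightarrow> x < m"
  shows "nested (unblocks m bs) \<longleftrightarrow>
    (\<forall>b\<in>set bs. nested b) \<and> sorted_wrt (\<lambda>b c. set b \<inter> set c = {}) bs"
  using assms
proof (induction m bs rule: unblocks.induct)
  case (3 m b c bs)
  have "nested (unblocks m (b # c # bs)) \<longleftrightarrow>
      nested b \<and> nested (unblocks m (c # bs)) \<and> set b \<inter> set (unblocks m (c # bs)) = {}"
    unfolding unblocks.simps
  proof (rule nested_append_Cons)
    fix x assume "x \<in> set (unblocks m (c # bs))"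
    then show "x \<le> m" using 3(2) unfolding set_unblocks by (fastforce split: if_splits simp: less_imp_le)
  qed (use 3(2) in auto)
  moreover have "m \<notin> set b" using 3(2) by auto
  then have "set b \<inter> set (unblocks m (c # bs)) = {} \<longleftrightarrow> (\<forall>d\<in>set (c # bs). set b \<inter> set d = {})"
    unfolding set_unblocks by (auto split: if_splits)
  ultimately show ?case using 3 by (auto simp del: unblocks.simps)
qed (auto simp: nested_def)

lemma count_unblocks:
  assumes "sorted_wrt (\<lambda>b c. set b \<inter> set c = {}) bs" "b \<in> set bs" "a \<in> set b" "a \<noteq> m"
  shows "count_list (unblocks m bs) a = count_list b a"
  using assms
proof (induction m bs rule: unblocks.induct)
  case (3 m c d bs)
  show ?case
  proof (cases "b = c")
    case True
    then have "a \<notin> set (unblocks m (d # bs))"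
      using 3(2,4,5) unfolding set_unblocks by (auto split: if_splits)
    then show ?thesis using True 3(5) by simp
  next
    case False
    then have "a \<notin> set c" using 3(2,3,4) by auto
    then show ?thesis using 3 False by simp
  qed
qed auto

text \<open>Joining \<open>r + 1\<close> blocks inserts exactly \<open>r\<close> copies of
  \<open>m\<close>. Disjointness confines every other letter to one block, where its multiplicity
  can be read off.\<close>

lemma rperm_unblocks_iff:
  assumes less: "\<And>b x. b \<in> set bs \<Longrightarrow> x \<in> set b \<Longrightarrow> x < m"
    and len: "length bs = Suc r"
  shows "rperm r (unblocks m bs) \<longleftrightarrow>
    (\<forall>b\<in>set bs. rperm r b) \<and> sorted_wrt (\<lambda>b c. set b \<inter> set c = {}) bs"
proof -
  have "m \<notin> \<Union>(set ` set bs)" using less by blast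
  then have "blocks m (unblocks m bs) = bs" using len by (intro blocks_unblocks) auto
  then have m: "count_list (unblocks m bs) m = r"
    using length_blocks[of m "unblocks m bs"] len by simp
  have "(\<forall>a\<in>set (unblocks m bs). count_list (unblocks m bs) a = r) \<longleftrightarrow>
      (\<forall>b\<in>set bs. \<forall>a\<in>set b. count_list b a = r)"
    if disj: "sorted_wrt (\<lambda>b c. set b \<inter> set c = {}) bs"
  proof -
    have "count_list (unblocks m bs) a = count_list b a" if "b \<in> set bs" "a \<in> set b" for a b
      using count_unblocks[OF disj that] less[OF that] by simp
    then show ?thesis unfolding set_unblocks by (auto simp: m split: if_splits)
  qed
  moreover have "nested (unblocks m bs) \<longleftrightarrow>
      (\<forall>b\<in>set bs. nested b) \<and> sorted_wrt (\<lambda>b c. set b \<inter> set c = {}) bs"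
    by (rule nested_unblocks_iff) (rule less)
  ultimately show ?thesis unfolding rperm_def by blast
qed

lemma set_stack_sort: "set (stack_sort w) = set w"
proof (induction w rule: length_induct)
  case (1 w)
  show ?case
  proof (cases "w = []")
    case False
    define m where "m = Max (set w)"
    have m: "m \<in> set w" "\<And>x. x \<in> set w \<Longrightarrow> x \<le> m" using False by (auto simp: m_def)
    have "set (stack_sort w) = (\<Union>b\<in>set (blocks m w). set (stack_sort b)) \<union> {m}"
      by (subst stack_sort_nonempty[OF m]) auto
    also have "\<dots> = (\<Union>b\<in>set (blocks m w). set b) \<union> {m}"
      using 1 length_block_less[OF m(1)] by auto
    also have "\<dots> = set (unblocks m (blocks m w))"
      using m(1) length_blocks[of m w] count_list_0_iff[of w m] unfolding set_unblocks by auto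
    finally show ?thesis by (simp add: unblocks_blocks)
  qed simp
qed

lemma stack_sort_eq_Nil_iff [simp]: "stack_sort w = [] \<longleftrightarrow> w = []"
  by (metis set_empty set_stack_sort)

lemma rperm_blocks:
  assumes "rperm r w" "m \<in> set w" "\<And>x. x \<in> set w \<Longrightarrow> x \<le> m"
  shows "length (blocks m w) = Suc r" "\<And>b. b \<in> set (blocks m w) \<Longrightarrow> rperm r b"
    "sorted_wrt (\<lambda>b c. set b \<inter> set c = {}) (blocks m w)"
    "\<And>b x. b \<in> set (blocks m w) \<Longrightarrow> x \<in> set b \<Longrightarrow> x < m"
proof -
  show len: "length (blocks m w) = Suc r"
    using assms(1,2) by (simp add: length_blocks rperm_def)
  show less: "x < m" if "b \<in> set (blocks m w)" "x \<in> set b" for b x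
    using set_block_subset[OF that(1)] that(2) assms(3) by (metis Diff_iff insertI1 nat_less_le subsetD)
  have "rperm r (unblocks m (blocks m w))" using assms(1) by (simp add: unblocks_blocks)
  moreover have "rperm r (unblocks m (blocks m w)) \<longleftrightarrow> (\<forall>b\<in>set (blocks m w). rperm r b) \<and>
      sorted_wrt (\<lambda>b c. set b \<inter> set c = {}) (blocks m w)"
    by (rule rperm_unblocks_iff[OF _ len]) (rule less)
  ultimately show "\<And>b. b \<in> set (blocks m w) \<Longrightarrow> rperm r b"
    "sorted_wrt (\<lambda>b c. set b \<inter> set c = {}) (blocks m w)"
    by blast+
qed

lemma distinct_concat_map_stack_sort_iff:
  assumes "\<And>b. b \<in> set bs \<Longrightarrow> distinct (stack_sort b)"
  shows "distinct (concat (map stack_sort bs)) \<longleftrightarrow> sorted_wrt (\<lambda>b c. set b \<inter> set c = {}) bs"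
  using assms by (induction bs) (auto simp: set_stack_sort)

text \<open>All copies of the maximum collapse to one final letter, and nesting keeps the letter
  sets of the blocks disjoint.\<close>

lemma distinct_stack_sort_rperm: "rperm r w \<Longrightarrow> distinct (stack_sort w)"
proof (induction w rule: length_induct)
  case (1 w)
  show ?case
  proof (cases "w = []")
    case False
    define m where "m = Max (set w)"
    have m: "m \<in> set w" "\<And>x. x \<in> set w \<Longrightarrow> x \<le> m" using False by (auto simp: m_def)
    note b = rperm_blocks[OF 1(2) m]
    have "distinct (concat (map stack_sort (blocks m w)))"
      using 1(1) b length_block_less[OF m(1)]
      by (subst distinct_concat_map_stack_sort_iff) auto
    moreover have "m \<notin> set (concat (map stack_sort (blocks m w)))"
      using b(4) by (fastforce simp: set_stack_sort)
    ultimately show ?thesis by (subst stack_sort_nonempty[OF m]) auto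
  qed simp
qed

section \<open>Counting trees and forests with a given postorder word\<close>

definition trees :: "nat \<Rightarrow> nat list \<Rightarrow> nat list set" where
  "trees r \<sigma> = {w. rperm r w \<and> stack_sort w = \<sigma>}"

text \<open>Disjointness of the letter sets is implicit: for a distinct word it follows from
  \<open>distinct_concat_map_stack_sort_iff\<close>. Empty words stand for empty trees.\<close>

definition forests :: "nat \<Rightarrow> nat \<Rightarrow> nat list \<Rightarrow> nat list list set" where
  "forests r j \<sigma> = {ws. length ws = j \<and> (\<forall>w\<in>set ws. rperm r w) \<and> concat (map stack_sort ws) = \<sigma>}"

lemma finite_rperms: "finite {w. rperm r w \<and> set w \<subseteq> set \<sigma>}"
proof (rule finite_subset)
  show "{w. rperm r w \<and> set w \<subseteq> set \<sigma>} \<subseteq> {w. set w \<subseteq> set \<sigma> \<and> length w \<le> r * card (set \<sigma>)}"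
  proof clarify
    fix w assume w: "rperm r w" "set w \<subseteq> set \<sigma>"
    have "length w = (\<Sum>a\<in>set w. count_list w a)" by (simp add: sum_count_set)
    also have "\<dots> = r * card (set w)" using w(1) by (simp add: rperm_def)
    also have "\<dots> \<le> r * card (set \<sigma>)" using w(2) by (simp add: card_mono)
    finally show "length w \<le> r * card (set \<sigma>)" .
  qed
qed (simp add: finite_lists_length_le)

lemma finite_trees: "finite (trees r \<sigma>)"
  by (rule finite_subset[OF _ finite_rperms[of r \<sigma>]]) (auto simp: trees_def set_stack_sort)

lemma finite_forests: "finite (forests r j \<sigma>)"
proof (rule finite_subset)
  show "forests r j \<sigma> \<subseteq> {ws. set ws \<subseteq> {w. rperm r w \<and> set w \<subseteq> set \<sigma>} \<and> length ws = j}"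
    by (auto simp: forests_def set_stack_sort)
qed (rule finite_lists_length_eq[OF finite_rperms])

lemma trees_Nil: "trees r [] = {[]}"
  by (auto simp: trees_def)

text \<open>The last letter of a postorder word is the root, hence the maximum. Removing it leaves
  the \<open>r + 1\<close> subtrees, which are the blocks of the word around its largest
  letter.\<close>

lemma card_trees_snoc:
  assumes "r \<ge> 1" "distinct (p @ [m])"
  shows "card (trees r (p @ [m])) = (if \<forall>x\<in>set p. x < m then card (forests r (Suc r) p) else 0)"
proof (cases "\<forall>x\<in>set p. x < m")
  case True
  have less: "x < m" if "bs \<in> forests r (Suc r) p" "b \<in> set bs" "x \<in> set b" for bs b x
    using that True by (auto simp: forests_def set_stack_sort)
  have blocks: "blocks m (unblocks m bs) = bs" if "bs \<in> forests r (Suc r) p" for bs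
  proof (rule blocks_unblocks)
    show "m \<notin> \<Union>(set ` set bs)" using less[OF that] by blast
    show "bs \<noteq> []" using that by (auto simp: forests_def)
  qed
  have "bij_betw (unblocks m) (forests r (Suc r) p) (trees r (p @ [m]))"
  proof (rule bij_betw_byWitness[where f' = "blocks m"])
    show "\<forall>bs\<in>forests r (Suc r) p. blocks m (unblocks m bs) = bs"
      using blocks by blast
    show "\<forall>w\<in>trees r (p @ [m]). unblocks m (blocks m w) = w" by (simp add: unblocks_blocks)
    show "unblocks m ` forests r (Suc r) p \<subseteq> trees r (p @ [m])"
    proof clarify
      fix bs assume bs: "bs \<in> forests r (Suc r) p"
      have len: "length bs = Suc r" and rp: "\<And>b. b \<in> set bs \<Longrightarrow> rperm r b"
        and p: "concat (map stack_sort bs) = p"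
        using bs by (auto simp: forests_def)
      have "sorted_wrt (\<lambda>b c. set b \<inter> set c = {}) bs"
        using assms distinct_concat_map_stack_sort_iff[of bs] distinct_stack_sort_rperm rp p by auto
      then have "rperm r (unblocks m bs)"
        using rperm_unblocks_iff[of bs m r] less[OF bs] len rp by blast
      moreover have "m \<in> set (unblocks m bs)" "\<And>x. x \<in> set (unblocks m bs) \<Longrightarrow> x \<le> m"
        using less[OF bs] len assms(1) unfolding set_unblocks
        by (auto split: if_splits intro: less_imp_le)
      then have "stack_sort (unblocks m bs) = p @ [m]"
        by (simp add: stack_sort_nonempty blocks[OF bs] p)
      ultimately show "unblocks m bs \<in> trees r (p @ [m])" by (simp add: trees_def)
    qed
    show "blocks m ` trees r (p @ [m]) \<subseteq> forests r (Suc r) p"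
    proof clarify
      fix w assume w: "w \<in> trees r (p @ [m])"
      then have "stack_sort w = p @ [m]" by (simp add: trees_def)
      then have "set w = set (p @ [m])" using set_stack_sort[of w] by simp
      then have m: "m \<in> set w" "\<And>x. x \<in> set w \<Longrightarrow> x \<le> m" using True by auto
      have "rperm r w" using w by (simp add: trees_def)
      note b = rperm_blocks[OF this m]
      show "blocks m w \<in> forests r (Suc r) p"
        using b(1,2) stack_sort_nonempty[OF m] w by (simp add: forests_def trees_def)
    qed
  qed
  then show ?thesis using True by (simp add: bij_betw_same_card)
next
  case False
  have "trees r (p @ [m]) = {}"
  proof (rule equals0I)
    fix w assume "w \<in> trees r (p @ [m])"
    then have w: "stack_sort w = p @ [m]" by (simp add: trees_def)
    then have "w \<noteq> []" by auto
    then have "Max (set w) \<in> set w" "\<And>x. x \<in> set w \<Longrightarrow> x \<le> Max (set w)" by auto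
    from stack_sort_nonempty[OF this] w have "Max (set w) = m" by simp
    moreover have "set w = insert m (set p)" using w set_stack_sort[of w] by simp
    ultimately have "\<forall>x\<in>set p. x \<le> m" using Max_ge[of "set w"] by auto
    moreover have "m \<notin> set p" using assms by auto
    ultimately show False using False by (auto simp: order.order_iff_strict)
  qed
  then show ?thesis unfolding if_not_P[OF False] by simp
qed

lemma card_forests_0: "card (forests r 0 \<sigma>) = (if \<sigma> = [] then 1 else 0)"
proof -
  have "forests r 0 \<sigma> = (if \<sigma> = [] then {[]} else {})" by (auto simp: forests_def)
  then show ?thesis by simp
qed

text \<open>The cut \<open>k\<close> is the length of the postorder word of the first tree.\<close>

lemma card_forests_Suc_split:
  "card (forests r (Suc j) \<sigma>) =
    (\<Sum>k\<le>length \<sigma>. card (trees r (take k \<sigma>)) * card (forests r j (drop k \<sigma>)))"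
proof -
  let ?S = "\<lambda>k. (\<lambda>(w, ws). w # ws) ` (trees r (take k \<sigma>) \<times> forests r j (drop k \<sigma>))"
  have "forests r (Suc j) \<sigma> = (\<Union>k\<le>length \<sigma>. ?S k)"
  proof (intro equalityI subsetI)
    fix ws assume "ws \<in> forests r (Suc j) \<sigma>"
    then obtain v vs where v: "ws = v # vs" "length vs = j" "rperm r v" "\<forall>w\<in>set vs. rperm r w"
      "stack_sort v @ concat (map stack_sort vs) = \<sigma>"
      by (cases ws) (auto simp: forests_def)
    then have "ws \<in> ?S (length (stack_sort v))"
      by (auto simp: trees_def forests_def)
    moreover have "length (stack_sort v) \<le> length \<sigma>" using v(5) by auto
    ultimately show "ws \<in> (\<Union>k\<le>length \<sigma>. ?S k)" by blast
  qed (auto simp: trees_def forests_def)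
  also have "card \<dots> = (\<Sum>k\<le>length \<sigma>. card (?S k))"
  proof (rule card_UN_disjoint)
    show "\<forall>k\<in>{..length \<sigma>}. \<forall>l\<in>{..length \<sigma>}. k \<noteq> l \<longrightarrow> ?S k \<inter> ?S l = {}"
    proof (intro ballI impI equals0I)
      fix k l ws assume kl: "k \<in> {..length \<sigma>}" "l \<in> {..length \<sigma>}" "k \<noteq> l" and "ws \<in> ?S k \<inter> ?S l"
      then have "take k \<sigma> = take l \<sigma>" by (auto simp: trees_def)
      then have "length (take k \<sigma>) = length (take l \<sigma>)" by simp
      then show False using kl by simp
    qed
  qed (auto simp: finite_trees finite_forests)
  also have "\<dots> = (\<Sum>k\<le>length \<sigma>. card (trees r (take k \<sigma>)) * card (forests r j (drop k \<sigma>)))"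
    by (intro sum.cong refl, subst card_image) (auto simp: inj_on_def card_cartesian_product)
  finally show ?thesis .
qed

text \<open>An empty first tree gives the first summand. Otherwise \<open>k\<close> is the position
  of its root in the word, which must exceed all letters before it.\<close>

lemma card_forests_Suc:
  assumes "r \<ge> 1" "distinct \<sigma>"
  shows "card (forests r (Suc j) \<sigma>) = card (forests r j \<sigma>) +
    (\<Sum>k<length \<sigma>. if \<forall>x\<in>set (take k \<sigma>). x < \<sigma> ! k
       then card (forests r (Suc r) (take k \<sigma>)) * card (forests r j (drop (Suc k) \<sigma>)) else 0)"
proof -
  have "{..length \<sigma>} = insert 0 (Suc ` {..<length \<sigma>})"
    by (auto simp: image_iff) (metis Suc_le_lessD Suc_pred not_gr_zero lessThan_iff)
  then have "card (forests r (Suc j) \<sigma>) = card (forests r j \<sigma>) +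
      (\<Sum>k<length \<sigma>. card (trees r (take (Suc k) \<sigma>)) * card (forests r j (drop (Suc k) \<sigma>)))"
    unfolding card_forests_Suc_split by (simp add: trees_Nil sum.reindex)
  also have "(\<Sum>k<length \<sigma>. card (trees r (take (Suc k) \<sigma>)) * card (forests r j (drop (Suc k) \<sigma>))) =
    (\<Sum>k<length \<sigma>. if \<forall>x\<in>set (take k \<sigma>). x < \<sigma> ! k
       then card (forests r (Suc r) (take k \<sigma>)) * card (forests r j (drop (Suc k) \<sigma>)) else 0)"
  proof (intro sum.cong refl)
    fix k assume "k \<in> {..<length \<sigma>}"
    then have k: "take (Suc k) \<sigma> = take k \<sigma> @ [\<sigma> ! k]" by (simp add: take_Suc_conv_app_nth)
    have "distinct (take k \<sigma> @ [\<sigma> ! k])" using assms(2) k by (metis distinct_take)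
    from card_trees_snoc[OF assms(1) this]
    show "card (trees r (take (Suc k) \<sigma>)) * card (forests r j (drop (Suc k) \<sigma>)) =
      (if \<forall>x\<in>set (take k \<sigma>). x < \<sigma> ! k
       then card (forests r (Suc r) (take k \<sigma>)) * card (forests r j (drop (Suc k) \<sigma>)) else 0)"
      by (simp add: k)
  qed
  finally show ?thesis .
qed

text \<open>The recurrence only compares letters, so the count depends on the relative order alone.
  It either lowers \<open>j\<close> on the same word or passes to shorter words with any
  \<open>j\<close>, whence the nested inductions.\<close>

lemma card_forests_map:
  assumes "r \<ge> 1" "strict_mono (f :: nat \<Rightarrow> nat)" "distinct \<sigma>"
  shows "card (forests r j (map f \<sigma>)) = card (forests r j \<sigma>)"
  using assms(3)
proof (induction "length \<sigma>" arbitrary: \<sigma> j rule: less_induct)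
  case less
  have d: "distinct (map f \<sigma>)"
    using less.prems strict_mono_eq[OF assms(2)] by (simp add: distinct_map inj_on_def)
  show ?case
  proof (induction j)
    case (Suc j)
    have "(if \<forall>x\<in>set (take k (map f \<sigma>)). x < map f \<sigma> ! k
       then card (forests r (Suc r) (take k (map f \<sigma>))) * card (forests r j (drop (Suc k) (map f \<sigma>))) else 0)
      = (if \<forall>x\<in>set (take k \<sigma>). x < \<sigma> ! k
       then card (forests r (Suc r) (take k \<sigma>)) * card (forests r j (drop (Suc k) \<sigma>)) else 0)"
      if "k < length \<sigma>" for k
      using that less.hyps[of "take k \<sigma>"] less.hyps[of "drop (Suc k) \<sigma>"] less.prems assms(2)
      by (simp add: take_map drop_map strict_mono_less)
    then show ?case
      unfolding card_forests_Suc[OF assms(1) d] card_forests_Suc[OF assms(1) less.prems] Suc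
      by simp
  qed (simp add: card_forests_0)
qed

section \<open>Avoiding 231\<close>

text \<open>\<open>bisects x w\<close> excludes letters \<open>c\<close>, \<open>d\<close> in this order with \<open>d < x < c\<close>, that is, a pattern
  231 starting with an \<open>x\<close> in front of \<open>w\<close>.\<close>

abbreviation bisects :: "nat \<Rightarrow> nat list \<Rightarrow> bool" where
  "bisects x \<equiv> sorted_wrt (\<lambda>c d. c < x \<or> x < d)"

primrec avoids231 :: "nat list \<Rightarrow> bool" where
  "avoids231 [] = True"
| "avoids231 (x # xs) = (bisects x xs \<and> avoids231 xs)"

text \<open>The four conditions are the four ways in which the three letters of a pattern can be
  spread over the two words.\<close>

lemma avoids231_append:
  "avoids231 (xs @ ys) \<longleftrightarrow> avoids231 xs \<and> avoids231 ys \<and> (\<forall>x\<in>set xs. bisects x ys) \<and>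
    sorted_wrt (\<lambda>x c. \<forall>d\<in>set ys. c < x \<or> x < d) xs"
proof (induction xs)
  case (Cons x xs)
  have "bisects x (xs @ ys) \<longleftrightarrow> bisects x xs \<and> bisects x ys \<and> (\<forall>c\<in>set xs. \<forall>d\<in>set ys. c < x \<or> x < d)"
    by (rule sorted_wrt_append)
  then show ?case
    unfolding append_Cons avoids231.simps sorted_wrt.simps list.set ball_simps Cons.IH by blast
qed simp

lemma bisects_if_all:
  "\<forall>c\<in>set xs. c < x \<Longrightarrow> bisects x xs" "\<forall>d\<in>set xs. x < d \<Longrightarrow> bisects x xs"
  by (induction xs) auto

lemma avoids231_map: "strict_mono f \<Longrightarrow> avoids231 (map f xs) \<longleftrightarrow> avoids231 xs"
  by (induction xs) (auto simp: sorted_wrt_map strict_mono_less)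

text \<open>The maximum can only act as the letter 3, and it does so as soon as a letter of
  \<open>u\<close> exceeds one of \<open>v\<close>.\<close>

lemma avoids231_append_Cons_max:
  assumes "\<forall>x\<in>set u \<union> set v. x < m"
  shows "avoids231 (u @ m # v) \<longleftrightarrow> avoids231 u \<and> avoids231 v \<and> (\<forall>x\<in>set u. \<forall>y\<in>set v. x < y)"
proof -
  have "bisects x (m # v) \<longleftrightarrow> (\<forall>y\<in>set v. x < y)" if "x \<in> set u" for x
  proof -
    have "x < m" using that assms by blast
    then show ?thesis using bisects_if_all(2)[of v x] by auto
  qed
  moreover have "sorted_wrt (\<lambda>x c. \<forall>d\<in>set (m # v). c < x \<or> x < d) u" if "\<forall>x\<in>set u. \<forall>y\<in>set v. x < y"
    by (rule sorted_wrt_mono_rel[of u "\<lambda>_ _. True"]) (use that assms in auto)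
  moreover have "bisects m v" using assms bisects_if_all(1)[of v m] by blast
  ultimately show ?thesis unfolding avoids231_append avoids231.simps by blast
qed

text \<open>Here \<open>m\<close> exceeds only the letters before it, so it may also act as the
  letter 2 of a pattern continued in \<open>v\<close>; the condition \<open>bisects m v\<close>
  excludes this.\<close>

lemma avoids231_append_Cons_record:
  assumes "\<forall>x\<in>set p. x < m"
  shows "avoids231 (p @ m # v) \<longleftrightarrow>
    avoids231 p \<and> avoids231 v \<and> (\<forall>x\<in>set p. \<forall>y\<in>set v. x < y) \<and> bisects m v"
proof -
  have "bisects x (m # v) \<longleftrightarrow> (\<forall>y\<in>set v. x < y)" if "x \<in> set p" for x
  proof -
    have "x < m" using that assms by blast
    then show ?thesis using bisects_if_all(2)[of v x] by auto
  qed
  moreover have "sorted_wrt (\<lambda>x c. \<forall>d\<in>set (m # v). c < x \<or> x < d) p" if "\<forall>x\<in>set p. \<forall>y\<in>set v. x < y"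
    by (rule sorted_wrt_mono_rel[of p "\<lambda>_ _. True"]) (use that assms in auto)
  ultimately show ?thesis unfolding avoids231_append avoids231.simps by blast
qed

text \<open>Knuth's criterion for stack-sortable permutations. Sortedness of the output decomposes
  at the maximum exactly as 231-avoidance does in \<open>avoids231_append_Cons_max\<close>.\<close>

lemma stack_sort_distinct:
  "distinct w \<Longrightarrow> distinct (stack_sort w) \<and> (sorted (stack_sort w) \<longleftrightarrow> avoids231 w)"
proof (induction w rule: length_induct)
  case (1 w)
  show ?case
  proof (cases "w = []")
    case False
    define m where "m = Max (set w)"
    have m: "m \<in> set w" "\<And>x. x \<in> set w \<Longrightarrow> x \<le> m" using False by (auto simp: m_def)
    obtain u v where w: "w = u @ m # v" using split_list[OF m(1)] by blast
    have less: "\<forall>x\<in>set u \<union> set v. x < m"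
      using m(2) 1(2) w by (auto simp: order.order_iff_strict)
    have disj: "set u \<inter> set v = {}" using 1(2) w by auto
    have u: "distinct (stack_sort u)" "sorted (stack_sort u) \<longleftrightarrow> avoids231 u"
      using 1 w by auto
    have v: "distinct (stack_sort v)" "sorted (stack_sort v) \<longleftrightarrow> avoids231 v"
      using 1 w by auto
    have S: "stack_sort w = stack_sort u @ stack_sort v @ [m]"
      unfolding w using less by (intro stack_sort_split) auto
    have "(\<forall>x\<in>set u. \<forall>y\<in>set v. x < y) \<longleftrightarrow> (\<forall>x\<in>set u. \<forall>y\<in>set v. x \<le> y)"
      using disj by (metis IntI empty_iff order.order_iff_strict)
    then have "sorted (stack_sort w) \<longleftrightarrow> avoids231 w"
      using less u v unfolding S unfolding w avoids231_append_Cons_max[OF less]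
      by (auto simp: sorted_append set_stack_sort less_imp_le)
    moreover have "distinct (stack_sort w)"
      unfolding S using u v less disj by (auto simp: set_stack_sort)
    ultimately show ?thesis by blast
  qed simp
qed

section \<open>Reduction of the count to 231-avoiding permutations\<close>

definition perms231 :: "nat \<Rightarrow> nat list set" where
  "perms231 n = {\<sigma>. distinct \<sigma> \<and> set \<sigma> = {1..n} \<and> avoids231 \<sigma>}"

lemma length_perms231: "\<sigma> \<in> perms231 n \<Longrightarrow> length \<sigma> = n"
  using distinct_card[of \<sigma>] by (simp add: perms231_def)

lemma finite_perms231: "finite (perms231 n)"
proof (rule finite_subset)
  show "perms231 n \<subseteq> {\<sigma>. set \<sigma> \<subseteq> {1..n} \<and> length \<sigma> = n}"
  proof
    fix \<sigma> assume "\<sigma> \<in> perms231 n"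
    then show "\<sigma> \<in> {\<sigma>. set \<sigma> \<subseteq> {1..n} \<and> length \<sigma> = n}"
      using length_perms231[of \<sigma> n] by (simp add: perms231_def)
  qed
qed (simp add: finite_lists_length_eq)

lemma perms231_0: "perms231 0 = {[]}"
proof -
  have "\<sigma> \<in> perms231 0 \<longleftrightarrow> \<sigma> = []" for \<sigma>
    unfolding perms231_def by (cases \<sigma>) simp_all
  then show ?thesis by blast
qed

text \<open>The first pass already yields distinct letters, so Knuth's criterion applies to the
  second. A sorted distinct list is determined by its set, which turns sortedness into equality with
  the identity.\<close>

lemma stack_sort_twice_iff:
  assumes "rperm r w"
  shows "set w = {1..n} \<and> stack_sort (stack_sort w) = [1..<n+1] \<longleftrightarrow> stack_sort w \<in> perms231 n"
proof -
  have d: "distinct (stack_sort w)" by (rule distinct_stack_sort_rperm[OF assms])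
  have iff: "stack_sort (stack_sort w) = [1..<n+1] \<longleftrightarrow> sorted (stack_sort (stack_sort w))"
    if "set w = {1..n}"
  proof
    assume "sorted (stack_sort (stack_sort w))"
    moreover have "set (stack_sort (stack_sort w)) = set [1..<n+1]"
      unfolding set_stack_sort that by auto
    ultimately show "stack_sort (stack_sort w) = [1..<n+1]"
      using stack_sort_distinct[of "stack_sort w"] stack_sort_distinct[OF d] sorted_upt distinct_upt
      by (metis sorted_distinct_set_unique)
  next
    assume "stack_sort (stack_sort w) = [1..<n+1]"
    then show "sorted (stack_sort (stack_sort w))" by (simp only: sorted_upt)
  qed
  then show ?thesis
    unfolding perms231_def mem_Collect_eq set_stack_sort
    using d stack_sort_distinct[OF d] by blast
qed

text \<open>Partitions the words by the result of the first pass.\<close>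

lemma card_twice_sorted:
  assumes "r \<ge> 1"
  shows "card {w. r_permutation r {1..n} w \<and> stack_sort (stack_sort w) = [1..<n+1]} =
    (\<Sum>\<sigma>\<in>perms231 n. card (trees r \<sigma>))"
proof -
  have "{w. r_permutation r {1..n} w \<and> stack_sort (stack_sort w) = [1..<n+1]} =
      (\<Union>\<sigma>\<in>perms231 n. trees r \<sigma>)"
    unfolding r_permutation_iff[OF assms] trees_def using stack_sort_twice_iff[of r _ n] by blast
  also have "card \<dots> = (\<Sum>\<sigma>\<in>perms231 n. card (trees r \<sigma>))"
    by (intro card_UN_disjoint finite_perms231 ballI finite_trees) (auto simp: trees_def)
  finally show ?thesis .
qed

lemma perms231_snoc_max:
  "{\<sigma> \<in> perms231 (Suc n). \<exists>p m. \<sigma> = p @ [m] \<and> (\<forall>x\<in>set p. x < m)} = (\<lambda>p. p @ [Suc n]) ` perms231 n"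
  (is "?l = ?r")
proof (intro equalityI subsetI)
  fix \<sigma> assume "\<sigma> \<in> ?l"
  then obtain p m where p: "\<sigma> = p @ [m]" "\<forall>x\<in>set p. x < m" "distinct \<sigma>" "set \<sigma> = {1..Suc n}" "avoids231 \<sigma>"
    by (auto simp: perms231_def)
  have "Suc n \<in> set \<sigma>" "m \<le> Suc n" using p(1,4) by auto
  then have m: "m = Suc n" using p(1,2) by (auto dest: leD)
  have "set p = set \<sigma> - {m}" using p(1,3) by auto
  then have "set p = {1..Suc n} - {Suc n}" unfolding p(4) m .
  moreover have "{1..Suc n} - {Suc n} = {1..n}" by auto
  ultimately have "set p = {1..n}" by (simp only:)
  moreover have "avoids231 p" using p(1,2,5) avoids231_append_Cons_max[of p "[]" m] by simp
  ultimately have "p \<in> perms231 n" using p(1,3) by (simp add: perms231_def)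
  with m show "\<sigma> \<in> ?r" using p(1) by blast
next
  fix \<sigma> assume "\<sigma> \<in> ?r"
  then obtain p where p: "\<sigma> = p @ [Suc n]" "p \<in> perms231 n" by blast
  then have less: "\<forall>x\<in>set p. x < Suc n" by (simp add: perms231_def)
  then have "avoids231 \<sigma>"
    using p avoids231_append_Cons_max[of p "[]" "Suc n"] by (simp add: perms231_def)
  moreover have "set \<sigma> = {1..Suc n}" "distinct \<sigma>"
    using p by (simp_all add: perms231_def atLeastAtMostSuc_conv)
  ultimately have "\<sigma> \<in> perms231 (Suc n)" by (simp add: perms231_def)
  then show "\<sigma> \<in> ?l" using p(1) less by blast
qed

text \<open>Only words ending in their maximum are postorder words of trees; deleting the root
  \<open>Suc n\<close> leaves a forest.\<close>

lemma sum_trees_eq_sum_forests: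
  assumes "r \<ge> 1"
  shows "(\<Sum>\<sigma>\<in>perms231 (Suc n). card (trees r \<sigma>)) = (\<Sum>p\<in>perms231 n. card (forests r (Suc r) p))"
proof -
  let ?M = "{\<sigma> \<in> perms231 (Suc n). \<exists>p m. \<sigma> = p @ [m] \<and> (\<forall>x\<in>set p. x < m)}"
  have "card (trees r \<sigma>) = 0" if "\<sigma> \<in> perms231 (Suc n) - ?M" for \<sigma>
  proof -
    have "\<sigma> \<noteq> []" using that length_perms231 by fastforce
    then obtain p m where "\<sigma> = p @ [m]" by (metis rev_exhaust)
    moreover from this have "\<not> (\<forall>x\<in>set p. x < m)" using that by blast
    ultimately show ?thesis using card_trees_snoc[OF assms, of p m] that by (auto simp: perms231_def)
  qed
  then have "(\<Sum>\<sigma>\<in>perms231 (Suc n). card (trees r \<sigma>)) = (\<Sum>\<sigma>\<in>?M. card (trees r \<sigma>))"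
    by (intro sum.mono_neutral_right finite_perms231 ballI) blast+
  also have "\<dots> = (\<Sum>p\<in>perms231 n. card (trees r (p @ [Suc n])))"
    unfolding perms231_snoc_max by (simp add: sum.reindex inj_on_def)
  also have "\<dots> = (\<Sum>p\<in>perms231 n. card (forests r (Suc r) p))"
  proof (intro sum.cong refl)
    fix p assume "p \<in> perms231 n"
    then have "distinct (p @ [Suc n])" "\<forall>x\<in>set p. x < Suc n" by (auto simp: perms231_def)
    then show "card (trees r (p @ [Suc n])) = card (forests r (Suc r) p)"
      using card_trees_snoc[OF assms] by simp
  qed
  finally show ?thesis .
qed

text \<open>The nonzero cuts are the ends of the direct sum components of \<open>v\<close>.\<close>

definition cuts :: "nat list \<Rightarrow> nat set" where
  "cuts v = {i. i \<le> length v \<and> (\<forall>a\<in>set (take i v). \<forall>b\<in>set (drop i v). a < b)}"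

definition comps :: "nat list \<Rightarrow> nat" where
  "comps v = card (cuts v - {0})"

lemma finite_cuts: "finite (cuts v)"
  by (rule finite_subset[of _ "{..length v}"]) (auto simp: cuts_def)

lemma zero_in_cuts: "0 \<in> cuts v"
  by (simp add: cuts_def)

lemma card_cuts: "card (cuts v) = Suc (comps v)"
  unfolding comps_def using card.remove[OF finite_cuts zero_in_cuts] by simp

lemma cuts_map: "strict_mono f \<Longrightarrow> cuts (map f v) = cuts v"
  by (auto simp: cuts_def take_map drop_map strict_mono_less)

text \<open>Each \<open>x\<close> in \<open>S\<close> brings all of \<open>{1..x}\<close> with it,
  so \<open>x\<close> is at most the size of \<open>S\<close>.\<close>

lemma initial_segment:
  assumes "S \<subseteq> {1..n}" "\<forall>x\<in>S. \<forall>y\<in>{1..n} - S. x < (y::nat)"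
  shows "S = {1..card S}"
proof -
  have fin: "finite S" using assms(1) finite_subset by blast
  have "S \<subseteq> {1..card S}"
  proof
    fix x assume x: "x \<in> S"
    have "{1..x} \<subseteq> S"
    proof
      fix y assume "y \<in> {1..x}"
      moreover have "x \<le> n" using x assms(1) by auto
      ultimately show "y \<in> S" using assms(2) x by (metis DiffI atLeastAtMost_iff leD le_trans)
    qed
    then have "card {1..x} \<le> card S" by (rule card_mono[OF fin])
    then show "x \<in> {1..card S}" using x assms(1) by auto
  qed
  then show ?thesis by (intro card_subset_eq) auto
qed

lemma set_take_cut:
  assumes "distinct v" "set v = {1..n}" "i \<in> cuts v"
  shows "set (take i v) = {1..i}" "set (drop i v) = {i<..n}"
proof -
  have i: "i \<le> length v" and less: "\<forall>a\<in>set (take i v). \<forall>b\<in>set (drop i v). a < b"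
    using assms(3) by (auto simp: cuts_def)
  have un: "set (take i v) \<union> set (drop i v) = {1..n}"
    using assms(2) by (metis append_take_drop_id set_append)
  have dj: "set (take i v) \<inter> set (drop i v) = {}"
    using assms(1) by (metis append_take_drop_id distinct_append)
  have "set (take i v) = {1..card (set (take i v))}"
    using un less by (intro initial_segment[of _ n]) auto
  also have "card (set (take i v)) = i"
    using distinct_card[of "take i v"] assms(1) i by simp
  finally show t: "set (take i v) = {1..i}" .
  have "set (drop i v) = {1..n} - {1..i}" using un dj unfolding t by blast
  also have "{1..n} - {1..i} = {i<..n}" by auto
  finally show "set (drop i v) = {i<..n}" .
qed

lemma bisects_filter:
  "sorted_wrt (\<lambda>c d. c \<le> i \<or> i < d) v \<Longrightarrow> v = filter (\<lambda>c. c \<le> i) v @ filter (\<lambda>c. i < c) v"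
  for i :: nat
proof (induction v)
  case (Cons x v)
  show ?case
  proof (cases "x \<le> i")
    case False
    then have "filter (\<lambda>c. c \<le> i) v = []" "filter (\<lambda>c. i < c) v = v"
      using Cons.prems by (auto simp: filter_empty_conv not_le)
    then show ?thesis using False by simp
  qed (use Cons in simp)
qed simp

text \<open>Translates a cut, a condition on positions, into one on values: a letter placed in front
  of \<open>v\<close> with value between \<open>i\<close> and \<open>i + 1\<close> starts no pattern
  231. Both say that the values \<open>1..i\<close> come first.\<close>

lemma mem_cuts_iff:
  assumes "distinct v" "set v = {1..n}" "i \<le> n"
  shows "i \<in> cuts v \<longleftrightarrow> sorted_wrt (\<lambda>c d. c \<le> i \<or> i < d) v"
proof
  assume i: "i \<in> cuts v"
  note s = set_take_cut[OF assms(1,2) i]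
  have "sorted_wrt (\<lambda>c d. c \<le> i \<or> i < d) (take i v @ drop i v)"
    unfolding sorted_wrt_append
  proof (intro conjI)
    show "sorted_wrt (\<lambda>c d. c \<le> i \<or> i < d) (take i v)"
      by (rule sorted_wrt_mono_rel[of _ "\<lambda>_ _. True"]) (use s(1) in auto)
    show "sorted_wrt (\<lambda>c d. c \<le> i \<or> i < d) (drop i v)"
      by (rule sorted_wrt_mono_rel[of _ "\<lambda>_ _. True"]) (use s(2) in auto)
  qed (use s in auto)
  then show "sorted_wrt (\<lambda>c d. c \<le> i \<or> i < d) v" by simp
next
  assume "sorted_wrt (\<lambda>c d. c \<le> i \<or> i < d) v"
  then have v: "v = filter (\<lambda>c. c \<le> i) v @ filter (\<lambda>c. i < c) v" by (rule bisects_filter)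
  have "length (filter (\<lambda>c. c \<le> i) v) = card (set (filter (\<lambda>c. c \<le> i) v))"
    using assms(1) by (intro distinct_card [symmetric]) simp
  also have "set (filter (\<lambda>c. c \<le> i) v) = {1..i}" using assms(2,3) by auto
  finally have len: "length (filter (\<lambda>c. c \<le> i) v) = i" by simp
  have "take i v = filter (\<lambda>c. c \<le> i) v" "drop i v = filter (\<lambda>c. i < c) v"
    using len v by (metis append_eq_conv_conj)+
  moreover have "length v = n" using assms by (metis card_atLeastAtMost diff_Suc_1 distinct_card)
  ultimately show "i \<in> cuts v" using assms(3) by (auto simp: cuts_def)
qed

section \<open>Prepending a tree\<close>

text \<open>Relabels the letters \<open>1, 2, ...\<close> increasingly by the values above
  \<open>k\<close>, leaving out \<open>Suc (k + i)\<close>, which is reserved for the root.\<close>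

definition skip :: "nat \<Rightarrow> nat \<Rightarrow> nat \<Rightarrow> nat" where
  "skip k i l = k + (if l \<le> i then l else Suc l)"

lemma strict_mono_skip: "strict_mono (skip k i)"
  by (rule strict_monoI) (auto simp: skip_def)

lemma skip_image:
  assumes "i \<le> l"
  shows "skip k i ` {1..l} = {Suc k..Suc (k + l)} - {Suc (k + i)}"
proof (intro equalityI subsetI)
  fix x assume x: "x \<in> {Suc k..Suc (k + l)} - {Suc (k + i)}"
  show "x \<in> skip k i ` {1..l}"
  proof (cases "x \<le> k + i")
    case True
    then have "x = skip k i (x - k)" "x - k \<in> {1..l}" using x assms by (auto simp: skip_def)
    then show ?thesis by blast
  next
    case False
    then have "x = skip k i (x - Suc k)" "x - Suc k \<in> {1..l}" using x assms by (auto simp: skip_def)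
    then show ?thesis by blast
  qed
next
  fix x assume "x \<in> skip k i ` {1..l}"
  then show "x \<in> {Suc k..Suc (k + l)} - {Suc (k + i)}" using assms by (auto simp: skip_def split: if_splits)
qed

lemma skip_less_iff: "skip k i c < Suc (k + i) \<longleftrightarrow> c \<le> i" "Suc (k + i) < skip k i c \<longleftrightarrow> i < c"
  by (auto simp: skip_def)

text \<open>The word of a forest with \<open>p\<close> from the subtrees of the first root,
  \<open>Suc (k + i)\<close> for that root and a relabelled \<open>v\<close> from the remaining
  trees.\<close>

definition merge :: "nat \<Rightarrow> nat list \<times> nat list \<times> nat \<Rightarrow> nat list" where
  "merge k = (\<lambda>(p, v, i). p @ Suc (k + i) # map (skip k i) v)"

definition records :: "nat \<Rightarrow> nat \<Rightarrow> nat list set" where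
  "records n k = {\<sigma> \<in> perms231 n. \<forall>x\<in>set (take k \<sigma>). x < \<sigma> ! k}"

lemma bisects_map_skip_iff:
  assumes "v \<in> perms231 l" "i \<le> l"
  shows "bisects (Suc (k + i)) (map (skip k i) v) \<longleftrightarrow> i \<in> cuts v"
proof -
  have "distinct v" "set v = {1..l}" using assms(1) by (simp_all add: perms231_def)
  from mem_cuts_iff[OF this assms(2)] show ?thesis by (simp add: sorted_wrt_map skip_less_iff)
qed

lemma cuts_le: "v \<in> perms231 l \<Longrightarrow> i \<in> cuts v \<Longrightarrow> i \<le> l"
  using length_perms231[of v l] by (simp add: cuts_def)

lemma merge_in_records:
  assumes "p \<in> perms231 k" "v \<in> perms231 l" "i \<in> cuts v"
  shows "merge k (p, v, i) \<in> records (Suc (k + l)) k"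
proof -
  have i: "i \<le> l" by (rule cuts_le[OF assms(2,3)])
  have p: "distinct p" "set p = {1..k}" "avoids231 p" and v: "distinct v" "set v = {1..l}" "avoids231 v"
    using assms by (simp_all add: perms231_def)
  have len: "length p = k" by (rule length_perms231[OF assms(1)])
  have set: "set (map (skip k i) v) = {Suc k..Suc (k + l)} - {Suc (k + i)}"
    by (simp only: set_map v skip_image[OF i])
  have less: "\<forall>x\<in>set p. x < Suc (k + i)" by (simp add: p)
  have "avoids231 (merge k (p, v, i))"
    unfolding merge_def prod.case avoids231_append_Cons_record[OF less] set
    using bisects_map_skip_iff[OF assms(2) i] assms(3) p v(3)
    by (auto simp: avoids231_map strict_mono_skip)
  moreover have "distinct (map (skip k i) v)"
    using v(1) strict_mono_eq[OF strict_mono_skip] by (simp add: distinct_map inj_on_def)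
  then have "distinct (merge k (p, v, i))"
    unfolding merge_def prod.case distinct_append distinct.simps list.set set p(2) using p(1) by auto
  moreover have "set (merge k (p, v, i)) = {1..k} \<union> insert (Suc (k + i)) ({Suc k..Suc (k + l)} - {Suc (k + i)})"
    unfolding merge_def prod.case set_append list.set set p(2) ..
  moreover have "\<dots> = {1..Suc (k + l)}" using i by auto
  ultimately have "merge k (p, v, i) \<in> perms231 (Suc (k + l))"
    unfolding perms231_def by simp
  moreover have "\<forall>x\<in>set (take k (merge k (p, v, i))). x < merge k (p, v, i) ! k"
    using less len by (simp add: merge_def nth_append)
  ultimately show ?thesis by (simp add: records_def)
qed

text \<open>Avoidance puts all letters before the record below all letters after it, so they form
  \<open>{1..k}\<close>. The rest omits only the record itself, and undoing \<open>skip\<close>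
  standardises it.\<close>

lemma records_merge:
  assumes "\<sigma> \<in> records (Suc (k + l)) k"
  shows "\<exists>p\<in>perms231 k. \<exists>v\<in>perms231 l. \<exists>i\<in>cuts v. \<sigma> = merge k (p, v, i)"
proof -
  define p m w where "p = take k \<sigma>" and "m = \<sigma> ! k" and "w = drop (Suc k) \<sigma>"
  have \<sigma>: "distinct \<sigma>" "set \<sigma> = {1..Suc (k + l)}" "avoids231 \<sigma>" "length \<sigma> = Suc (k + l)"
    and less: "\<forall>x\<in>set p. x < m"
    using assms length_perms231[of \<sigma>] by (simp_all add: records_def perms231_def p_def m_def)
  have split: "\<sigma> = p @ m # w" unfolding p_def m_def w_def using \<sigma>(4) by (intro id_take_nth_drop) simp
  have len: "length p = k" "length w = l" using \<sigma>(4) by (simp_all add: p_def w_def)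
  note av = \<sigma>(3)[unfolded split avoids231_append_Cons_record[OF less]]
  have dist: "distinct p" "distinct w" "m \<notin> set p" "m \<notin> set w" "set p \<inter> set w = {}"
    using \<sigma>(1) unfolding split by auto
  have un: "set p \<union> insert m (set w) = {1..Suc (k + l)}"
    using \<sigma>(2) unfolding split by simp
  have "set p = {1..card (set p)}"
    using un less av by (intro initial_segment[of _ "Suc (k + l)"]) blast+
  then have p: "set p = {1..k}" using len(1) dist(1) by (simp add: distinct_card)
  have mem: "m \<in> {1..Suc (k + l)}" using un by blast
  have "m \<notin> {1..k}" using dist(3) unfolding p .
  with mem have "Suc k \<le> m" "m \<le> Suc (k + l)" by auto
  then obtain i where i: "m = Suc (k + i)" "i \<le> l"
    by (metis Suc_le_mono add_Suc add_le_cancel_left le_Suc_ex)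
  have "set w = {1..Suc (k + l)} - {1..k} - {m}"
    using un dist unfolding p by blast
  also have "\<dots> = {Suc k..Suc (k + l)} - {Suc (k + i)}" unfolding i by auto
  also have "\<dots> = skip k i ` {1..l}" by (rule skip_image[OF i(2), symmetric])
  finally have w: "set w = skip k i ` {1..l}" .
  define v where "v = map (inv (skip k i)) w"
  have inj: "inj (skip k i)" using strict_mono_eq[OF strict_mono_skip] by (simp add: inj_def)
  have wv: "w = map (skip k i) v"
    unfolding v_def map_map by (rule map_idI [symmetric]) (use w inj in auto)
  have "skip k i ` set v = skip k i ` {1..l}" using w wv by (metis set_map)
  then have "set v = {1..l}" using inj by (simp add: inj_image_eq_iff)
  moreover have "distinct v" using dist(2) unfolding wv by (simp add: distinct_map)
  moreover have "avoids231 v" using av unfolding wv by (simp add: avoids231_map strict_mono_skip)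
  ultimately have v: "v \<in> perms231 l" by (simp add: perms231_def)
  have "i \<in> cuts v" using av unfolding wv i(1) bisects_map_skip_iff[OF v i(2)] by blast
  moreover have "p \<in> perms231 k" using p dist(1) av by (simp add: perms231_def)
  moreover have "\<sigma> = merge k (p, v, i)" by (simp add: merge_def split wv i(1))
  ultimately show ?thesis using v by blast
qed

lemma bij_betw_merge:
  "bij_betw (merge k) (SIGMA p:perms231 k. SIGMA v:perms231 l. cuts v) (records (Suc (k + l)) k)"
proof (rule bij_betw_imageI)
  show "inj_on (merge k) (SIGMA p:perms231 k. SIGMA v:perms231 l. cuts v)"
  proof (rule inj_onI)
    fix x y
    assume xy: "x \<in> (SIGMA p:perms231 k. SIGMA v:perms231 l. cuts v)"
      "y \<in> (SIGMA p:perms231 k. SIGMA v:perms231 l. cuts v)" "merge k x = merge k y"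
    obtain p v i p' v' i' where x: "x = (p, v, i)" and y: "y = (p', v', i')"
      by (metis prod_cases3)
    have eq: "merge k (p, v, i) = merge k (p', v', i')" and mem: "p \<in> perms231 k" "p' \<in> perms231 k"
      using xy unfolding x y by simp_all
    have "length p = length p'" using mem length_perms231 by metis
    with eq have "p = p'" "i = i'" and vv: "map (skip k i) v = map (skip k i) v'"
      by (auto simp: merge_def)
    moreover have "inj (skip k i)" using strict_mono_eq[OF strict_mono_skip] by (simp add: inj_def)
    with vv have "v = v'" by (simp add: inj_map_eq_map)
    ultimately show "x = y" by (simp add: x y)
  qed
  show "merge k ` (SIGMA p:perms231 k. SIGMA v:perms231 l. cuts v) = records (Suc (k + l)) k"
  proof (intro equalityI subsetI)
    fix \<sigma> assume "\<sigma> \<in> records (Suc (k + l)) k"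
    from records_merge[OF this] show "\<sigma> \<in> merge k ` (SIGMA p:perms231 k. SIGMA v:perms231 l. cuts v)"
      by blast
  qed (use merge_in_records in auto)
qed

text \<open>Cuts up to position \<open>k\<close> are those of \<open>p\<close>, because everything
  later is larger. Beyond the root they are the cuts of \<open>v\<close> moved by
  \<open>k + 1\<close>, and a cut \<open>j\<close> survives iff the root value lies below everything
  after it, that is, iff \<open>i <= j\<close>.\<close>

lemma comps_merge:
  assumes "p \<in> perms231 k" "v \<in> perms231 l" "i \<in> cuts v"
  shows "comps (merge k (p, v, i)) = comps p + card {j \<in> cuts v. i \<le> j}"
proof -
  define w where "w = map (skip k i) v"
  define \<sigma> where "\<sigma> = merge k (p, v, i)"
  have \<sigma>: "\<sigma> = p @ Suc (k + i) # w" by (simp add: \<sigma>_def merge_def w_def)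
  have i: "i \<le> l" by (rule cuts_le[OF assms(2,3)])
  have len: "length p = k" "length w = l" "length v = l"
    using length_perms231 assms(1,2) by (auto simp: w_def)
  have p: "set p = {1..k}" and v: "distinct v" "set v = {1..l}"
    using assms by (simp_all add: perms231_def)
  have w: "set w = {Suc k..Suc (k + l)} - {Suc (k + i)}"
    by (simp only: w_def set_map v skip_image[OF i])
  have wk: "\<forall>b\<in>set w. Suc k \<le> b" unfolding w by simp
  have low: "j \<in> cuts \<sigma> \<longleftrightarrow> j \<in> cuts p" if "j \<le> k" for j
  proof -
    have "take j \<sigma> = take j p" "drop j \<sigma> = drop j p @ Suc (k + i) # w"
      using that len by (simp_all add: \<sigma>)
    then have "j \<in> cuts \<sigma> \<longleftrightarrow>
        (\<forall>a\<in>set (take j p). \<forall>b\<in>set (drop j p) \<union> insert (Suc (k + i)) (set w). a < b)"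
      using that len by (simp add: cuts_def \<sigma>)
    moreover have "a < b" if "a \<in> set (take j p)" "b \<in> insert (Suc (k + i)) (set w)" for a b
    proof -
      have "a \<le> k" using in_set_takeD[OF that(1)] p by simp
      moreover have "Suc k \<le> b" using that(2) wk by auto
      ultimately show ?thesis by simp
    qed
    ultimately show ?thesis using that len unfolding cuts_def by blast
  qed
  have high: "Suc (k + j) \<in> cuts \<sigma> \<longleftrightarrow> j \<in> cuts v \<and> i \<le> j" if "j \<le> l" for j
  proof -
    have "take (Suc (k + j)) \<sigma> = p @ Suc (k + i) # take j w" "drop (Suc (k + j)) \<sigma> = drop j w"
      using len by (simp_all add: \<sigma>)
    then have "Suc (k + j) \<in> cuts \<sigma> \<longleftrightarrow>
        (\<forall>a\<in>set p \<union> insert (Suc (k + i)) (set (take j w)). \<forall>b\<in>set (drop j w). a < b)"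
      using that len by (simp add: cuts_def \<sigma>)
    also have "\<dots> \<longleftrightarrow> (\<forall>a\<in>set p. \<forall>b\<in>set (drop j w). a < b) \<and>
        (\<forall>b\<in>set (drop j w). Suc (k + i) < b) \<and> j \<in> cuts w"
      using that len unfolding cuts_def by blast
    also have "(\<forall>a\<in>set p. \<forall>b\<in>set (drop j w). a < b) \<longleftrightarrow> True"
    proof -
      have "a < b" if "a \<in> set p" "b \<in> set (drop j w)" for a b
      proof -
        have "a \<le> k" using that(1) p by simp
        moreover have "Suc k \<le> b" using wk in_set_dropD[OF that(2)] by blast
        ultimately show ?thesis by simp
      qed
      then show ?thesis by blast
    qed
    also have "j \<in> cuts w \<longleftrightarrow> j \<in> cuts v" unfolding w_def by (simp add: cuts_map strict_mono_skip)
    also have "(\<forall>b\<in>set (drop j w). Suc (k + i) < b) \<longleftrightarrow> (\<forall>b\<in>set (drop j v). i < b)"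
      by (simp add: w_def drop_map skip_less_iff)
    finally have "Suc (k + j) \<in> cuts \<sigma> \<longleftrightarrow> (\<forall>b\<in>set (drop j v). i < b) \<and> j \<in> cuts v" by blast
    moreover have "(\<forall>b\<in>set (drop j v). i < b) \<longleftrightarrow> i \<le> j" if "j \<in> cuts v"
    proof -
      have drop: "set (drop j v) = {j<..l}" by (rule set_take_cut(2)[OF v that])
      show ?thesis
        unfolding drop using i cuts_le[OF assms(2) that] by (cases "j = l") auto
    qed
    ultimately show ?thesis by blast
  qed
  have "cuts \<sigma> - {0} = (cuts p - {0}) \<union> (\<lambda>j. Suc (k + j)) ` {j \<in> cuts v. i \<le> j}"
  proof (intro equalityI subsetI)
    fix j assume j: "j \<in> cuts \<sigma> - {0}"
    show "j \<in> (cuts p - {0}) \<union> (\<lambda>j. Suc (k + j)) ` {j \<in> cuts v. i \<le> j}"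
    proof (cases "j \<le> k")
      case False
      define j' where "j' = j - Suc k"
      have j': "j = Suc (k + j')" using False by (simp add: j'_def)
      moreover have "j \<le> length \<sigma>" using j by (simp add: cuts_def)
      then have "j' \<le> l" using j' len by (simp add: \<sigma>)
      ultimately have "j' \<in> {j \<in> cuts v. i \<le> j}" using high j by blast
      then show ?thesis using j' by blast
    qed (use low j in blast)
  next
    fix j assume "j \<in> (cuts p - {0}) \<union> (\<lambda>j. Suc (k + j)) ` {j \<in> cuts v. i \<le> j}"
    then show "j \<in> cuts \<sigma> - {0}"
    proof
      assume "j \<in> cuts p - {0}"
      then show ?thesis using low[of j] cuts_le[OF assms(1)] by blast
    next
      assume "j \<in> (\<lambda>j. Suc (k + j)) ` {j \<in> cuts v. i \<le> j}"
      then show ?thesis using high cuts_le[OF assms(2)] by blast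
    qed
  qed
  moreover have "(cuts p - {0}) \<inter> (\<lambda>j. Suc (k + j)) ` {j \<in> cuts v. i \<le> j} = {}"
    using cuts_le[OF assms(1)] by fastforce
  ultimately have "card (cuts \<sigma> - {0}) =
      card (cuts p - {0}) + card ((\<lambda>j. Suc (k + j)) ` {j \<in> cuts v. i \<le> j})"
    by (simp add: card_Un_disjoint finite_cuts)
  then show ?thesis
    unfolding comps_def \<sigma>_def by (simp add: card_image inj_on_def)
qed

text \<open>As \<open>i\<close> runs through \<open>C\<close>, the number of elements from
  \<open>i\<close> upwards takes each value from 1 to the size of \<open>C\<close> once. The
  induction adds a new minimum.\<close>

lemma sum_upper_card:
  fixes f :: "nat \<Rightarrow> 'a::comm_monoid_add" and C :: "'b::linorder set"
  assumes "finite C"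
  shows "(\<Sum>i\<in>C. f (card {j \<in> C. i \<le> j})) = (\<Sum>e<card C. f (Suc e))"
  using assms
proof (induction rule: finite_linorder_min_induct)
  case (insert b C)
  have "b \<notin> C" using insert by auto
  have "{j \<in> insert b C. i \<le> j} = {j \<in> C. i \<le> j}" if "i \<in> C" for i
    using insert(2) that by auto
  then have "(\<Sum>i\<in>C. f (card {j \<in> insert b C. i \<le> j})) = (\<Sum>i\<in>C. f (card {j \<in> C. i \<le> j}))"
    by (intro sum.cong) auto
  moreover have "{j \<in> insert b C. b \<le> j} = insert b C"
    using insert(2) by auto
  ultimately show ?case
    using insert \<open>b \<notin> C\<close> by (simp add: add.commute)
qed simp

section \<open>Generating functions by size and number of components\<close>

text \<open>The coefficient of \<open>x^n\<close> in the series \<open>F j\<close>, expanded in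
  \<open>u - 1\<close>, so that setting \<open>u = 1\<close> means taking the constant
  coefficient.\<close>

definition forest_gf :: "nat \<Rightarrow> nat \<Rightarrow> nat \<Rightarrow> real fps" where
  "forest_gf r j n = (\<Sum>\<sigma>\<in>perms231 n. of_nat (card (forests r j \<sigma>)) * (1 + fps_X) ^ comps \<sigma>)"

text \<open>Both sides are \<open>(u^(c+1) - 1) / (u - 1)\<close> with \<open>u = 1 + X\<close>; the
  shift of \<open>u^c\<close> is \<open>(u^c - 1) / (u - 1)\<close>.\<close>

lemma divided_difference_power:
  "(\<Sum>e\<le>c. (1 + fps_X) ^ e) = (1 + fps_X) ^ c + fps_shift 1 ((1 + fps_X :: 'a::idom fps) ^ c)"
proof -
  have "((1 + fps_X :: 'a fps) ^ c) $ 0 = 1" by (simp add: fps_nth_power_0)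
  then have shift: "fps_X * fps_shift 1 ((1 + fps_X :: 'a fps) ^ c) = (1 + fps_X) ^ c - 1"
    by (intro fps_ext) (auto simp: fps_X_mult_nth)
  have "fps_X * (\<Sum>e\<le>c. (1 + fps_X :: 'a fps) ^ e) = (1 + fps_X) ^ Suc c - 1"
    using power_diff_1_eq[of "1 + fps_X :: 'a fps" "Suc c"] by (simp add: lessThan_Suc_atMost)
  also have "\<dots> = fps_X * ((1 + fps_X) ^ c + fps_shift 1 ((1 + fps_X) ^ c))"
    unfolding distrib_left shift by (simp add: distrib_right)
  finally show ?thesis by simp
qed

lemma divided_difference_forest_gf:
  "(\<Sum>\<sigma>\<in>perms231 n. of_nat (card (forests r j \<sigma>)) * (\<Sum>e\<le>comps \<sigma>. (1 + fps_X) ^ e)) =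
    forest_gf r j n + fps_shift 1 (forest_gf r j n)"
proof -
  have "fps_shift 1 (forest_gf r j n) = (\<Sum>\<sigma>\<in>perms231 n. of_nat (card (forests r j \<sigma>)) * fps_shift 1 ((1 + fps_X) ^ comps \<sigma>))"
    by (intro fps_ext) (simp add: forest_gf_def fps_sum_nth fps_mult_of_nat_nth)
  then show ?thesis
    unfolding divided_difference_power by (simp add: forest_gf_def distrib_left sum.distrib)
qed

lemma forest_gf_0: "forest_gf r 0 n = (if n = 0 then 1 else 0)"
proof (cases "n = 0")
  case True
  then show ?thesis by (simp add: forest_gf_def perms231_0 card_forests_0 comps_def cuts_def)
next
  case False
  then have "card (forests r 0 \<sigma>) = 0" if "\<sigma> \<in> perms231 n" for \<sigma>
    using length_perms231[OF that] by (auto simp: card_forests_0)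
  then show ?thesis using False by (simp add: forest_gf_def)
qed

text \<open>Pulling back along \<open>merge\<close> separates the factors for \<open>p\<close> and
  \<open>v\<close>. The choice of the cut contributes \<open>u + ... + u^(comps v + 1)\<close>,
  which is \<open>u\<close> times a divided difference.\<close>

lemma sum_records:
  assumes r: "r \<ge> 1"
  shows "(\<Sum>\<sigma>\<in>records (Suc (k + l)) k. of_nat (card (forests r (Suc r) (take k \<sigma>)) *
        card (forests r j (drop (Suc k) \<sigma>))) * (1 + fps_X) ^ comps \<sigma>) =
    (1 + fps_X) * forest_gf r (Suc r) k * (forest_gf r j l + fps_shift 1 (forest_gf r j l))"
proof -
  let ?U = "1 + fps_X :: real fps"
  let ?f = "\<lambda>p. of_nat (card (forests r (Suc r) p)) :: real fps"
  let ?g = "\<lambda>v. of_nat (card (forests r j v)) :: real fps"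
  have "(\<Sum>\<sigma>\<in>records (Suc (k + l)) k. of_nat (card (forests r (Suc r) (take k \<sigma>)) *
        card (forests r j (drop (Suc k) \<sigma>))) * ?U ^ comps \<sigma>) =
      (\<Sum>x\<in>(SIGMA p:perms231 k. SIGMA v:perms231 l. cuts v).
        of_nat (card (forests r (Suc r) (take k (merge k x))) *
        card (forests r j (drop (Suc k) (merge k x)))) * ?U ^ comps (merge k x))"
    by (rule sum.reindex_bij_betw[OF bij_betw_merge, symmetric])
  also have "\<dots> = (\<Sum>(p, v, i)\<in>(SIGMA p:perms231 k. SIGMA v:perms231 l. cuts v).
      ?f p * ?U ^ comps p * (?g v * ?U ^ card {j \<in> cuts v. i \<le> j}))"
  proof (intro sum.cong refl, clarify)
    fix p v i assume pvi: "p \<in> perms231 k" "v \<in> perms231 l" "i \<in> cuts v"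
    have "length p = k" by (rule length_perms231[OF pvi(1)])
    then have "take k (merge k (p, v, i)) = p" "drop (Suc k) (merge k (p, v, i)) = map (skip k i) v"
      by (simp_all add: merge_def)
    moreover have "card (forests r j (map (skip k i) v)) = card (forests r j v)"
      using pvi(2) by (intro card_forests_map r strict_mono_skip) (simp add: perms231_def)
    ultimately show "of_nat (card (forests r (Suc r) (take k (merge k (p, v, i)))) *
        card (forests r j (drop (Suc k) (merge k (p, v, i))))) * ?U ^ comps (merge k (p, v, i)) =
      ?f p * ?U ^ comps p * (?g v * ?U ^ card {j \<in> cuts v. i \<le> j})"
      by (simp add: comps_merge[OF pvi] power_add mult_ac)
  qed
  also have "\<dots> = (\<Sum>p\<in>perms231 k. \<Sum>v\<in>perms231 l. \<Sum>i\<in>cuts v.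
      ?f p * ?U ^ comps p * (?g v * ?U ^ card {j \<in> cuts v. i \<le> j}))"
    by (subst sum.Sigma [symmetric], simp_all add: finite_perms231 finite_cuts finite_SigmaI,
        intro sum.cong refl, subst sum.Sigma [symmetric], simp_all add: finite_perms231 finite_cuts)
  also have "\<dots> = forest_gf r (Suc r) k * (\<Sum>v\<in>perms231 l. ?g v * (\<Sum>i\<in>cuts v. ?U ^ card {j \<in> cuts v. i \<le> j}))"
    unfolding forest_gf_def sum_product by (simp add: sum_distrib_left)
  also have "(\<Sum>v\<in>perms231 l. ?g v * (\<Sum>i\<in>cuts v. ?U ^ card {j \<in> cuts v. i \<le> j})) =
      ?U * (\<Sum>v\<in>perms231 l. ?g v * (\<Sum>e\<le>comps v. ?U ^ e))"
  proof -
    have "(\<Sum>i\<in>cuts v. ?U ^ card {j \<in> cuts v. i \<le> j}) = ?U * (\<Sum>e\<le>comps v. ?U ^ e)" for v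
      unfolding sum_upper_card[OF finite_cuts, of "\<lambda>e. ?U ^ e"] card_cuts lessThan_Suc_atMost
      by (simp only: power_Suc sum_distrib_left)
    then have "(\<Sum>v\<in>perms231 l. ?g v * (\<Sum>i\<in>cuts v. ?U ^ card {j \<in> cuts v. i \<le> j})) =
        (\<Sum>v\<in>perms231 l. ?U * (?g v * (\<Sum>e\<le>comps v. ?U ^ e)))"
      by (intro sum.cong refl) (simp only: mult.left_commute)
    also have "\<dots> = ?U * (\<Sum>v\<in>perms231 l. ?g v * (\<Sum>e\<le>comps v. ?U ^ e))"
      by (rule sum_distrib_left [symmetric])
    finally show ?thesis .
  qed
  finally show ?thesis unfolding divided_difference_forest_gf by (simp only: mult_ac)
qed

text \<open>Sums \<open>card_forests_Suc\<close> over all avoiding permutations; \<open>k\<close> is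
  the number of letters in the first tree apart from its root.\<close>

lemma forest_gf_Suc:
  assumes r: "r \<ge> 1"
  shows "forest_gf r (Suc j) n = forest_gf r j n +
    (\<Sum>k<n. (1 + fps_X) * forest_gf r (Suc r) k * (forest_gf r j (n - Suc k) + fps_shift 1 (forest_gf r j (n - Suc k))))"
proof -
  let ?U = "1 + fps_X :: real fps"
  let ?c = "\<lambda>k \<sigma>. card (forests r (Suc r) (take k \<sigma>)) * card (forests r j (drop (Suc k) \<sigma>))"
  have "forest_gf r (Suc j) n = (\<Sum>\<sigma>\<in>perms231 n. of_nat (card (forests r j \<sigma>)) * ?U ^ comps \<sigma> +
      (\<Sum>k<n. if \<sigma> \<in> records n k then of_nat (?c k \<sigma>) * ?U ^ comps \<sigma> else 0))"
    unfolding forest_gf_def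
  proof (intro sum.cong refl)
    fix \<sigma> assume \<sigma>: "\<sigma> \<in> perms231 n"
    then have "distinct \<sigma>" "length \<sigma> = n" using length_perms231 by (simp_all add: perms231_def)
    then have "of_nat (card (forests r (Suc j) \<sigma>)) = (of_nat (card (forests r j \<sigma>)) +
        (\<Sum>k<n. if \<sigma> \<in> records n k then of_nat (?c k \<sigma>) else 0) :: real fps)"
      using \<sigma> by (simp add: card_forests_Suc[OF r] records_def if_distrib[of of_nat] cong: if_cong)
    then show "of_nat (card (forests r (Suc j) \<sigma>)) * ?U ^ comps \<sigma> =
        of_nat (card (forests r j \<sigma>)) * ?U ^ comps \<sigma> +
        (\<Sum>k<n. if \<sigma> \<in> records n k then of_nat (?c k \<sigma>) * ?U ^ comps \<sigma> else 0)"
      by (simp add: distrib_right sum_distrib_right if_distrib[of "\<lambda>x. x * _"] cong: if_cong)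
  qed
  also have "\<dots> = forest_gf r j n +
      (\<Sum>k<n. \<Sum>\<sigma>\<in>perms231 n. if \<sigma> \<in> records n k then of_nat (?c k \<sigma>) * ?U ^ comps \<sigma> else 0)"
    unfolding sum.distrib forest_gf_def by (subst sum.swap) (rule refl)
  also have "(\<Sum>k<n. \<Sum>\<sigma>\<in>perms231 n. if \<sigma> \<in> records n k then of_nat (?c k \<sigma>) * ?U ^ comps \<sigma> else 0) =
      (\<Sum>k<n. ?U * forest_gf r (Suc r) k * (forest_gf r j (n - Suc k) + fps_shift 1 (forest_gf r j (n - Suc k))))"
  proof (intro sum.cong refl)
    fix k assume "k \<in> {..<n}"
    then have n: "n = Suc (k + (n - Suc k))" by simp
    have "perms231 n \<inter> {\<sigma>. \<sigma> \<in> records n k} = records n k" by (auto simp: records_def)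
    then have "(\<Sum>\<sigma>\<in>perms231 n. if \<sigma> \<in> records n k then of_nat (?c k \<sigma>) * ?U ^ comps \<sigma> else 0) =
        (\<Sum>\<sigma>\<in>records n k. of_nat (?c k \<sigma>) * ?U ^ comps \<sigma>)"
      by (simp add: sum.If_cases finite_perms231)
    also have "\<dots> = ?U * forest_gf r (Suc r) k * (forest_gf r j (n - Suc k) + fps_shift 1 (forest_gf r j (n - Suc k)))"
      using sum_records[OF r, of k j "n - Suc k"] unfolding n [symmetric] .
    finally show "(\<Sum>\<sigma>\<in>perms231 n. if \<sigma> \<in> records n k then of_nat (?c k \<sigma>) * ?U ^ comps \<sigma> else 0) =
        ?U * forest_gf r (Suc r) k * (forest_gf r j (n - Suc k) + fps_shift 1 (forest_gf r j (n - Suc k)))" .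
  qed
  finally show ?thesis .
qed

section \<open>The count\<close>

text \<open>Turns a sequence indexed by powers of \<open>x\<close>, with entries in
  \<open>u - 1\<close>, into a series with outer variable \<open>u - 1\<close> and inner variable
  \<open>x\<close>, as \<open>catalytic_coefficient\<close> expects.\<close>

definition fps_transpose :: "(nat \<Rightarrow> 'a::comm_ring_1 fps) \<Rightarrow> 'a fps fps" where
  "fps_transpose f = Abs_fps (\<lambda>k. Abs_fps (\<lambda>n. f n $ k))"

lemma fps_transpose_nth [simp]: "fps_transpose f $ k $ n = f n $ k"
  by (simp add: fps_transpose_def)

lemma fps_transpose_eqI: "(\<And>k n. F $ k $ n = f n $ k) \<Longrightarrow> F = fps_transpose f"
  by (simp add: fps_eq_iff)

lemma fps_transpose_mult:
  "fps_transpose f * fps_transpose g = fps_transpose (\<lambda>n. \<Sum>i\<le>n. f i * g (n - i))"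
proof (rule fps_transpose_eqI)
  fix k n
  have "(fps_transpose f * fps_transpose g) $ k $ n =
      (\<Sum>a\<le>k. \<Sum>i\<le>n. f i $ a * g (n - i) $ (k - a))"
    by (simp add: fps_mult_nth fps_sum_nth atLeast0AtMost)
  also have "\<dots> = (\<Sum>i\<le>n. \<Sum>a\<le>k. f i $ a * g (n - i) $ (k - a))" by (rule sum.swap)
  also have "\<dots> = (\<Sum>i\<le>n. f i * g (n - i)) $ k"
    by (simp add: fps_mult_nth fps_sum_nth atLeast0AtMost)
  finally show "(fps_transpose f * fps_transpose g) $ k $ n = (\<Sum>i\<le>n. f i * g (n - i)) $ k" .
qed

theorem theorem5:
  fixes r n :: nat
  assumes "r \<ge> 1" and "n \<ge> 1"
  shows "real (card {w. r_permutation r {1..n} w \<and> stack_sort (stack_sort w) = [1..<n+1]}) =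
         2 * (real r + 1) * fact ((2 * r + 1) * n) / (fact n * fact (2 * r * n + 2))"
proof -
  define F where "F j = fps_transpose (forest_gf r j)" for j
  define T where "T = fps_const fps_X * (1 + fps_X) * F (Suc r)"
  have T: "T = fps_transpose (\<lambda>n. if n = 0 then 0 else (1 + fps_X) * forest_gf r (Suc r) (n - 1))"
    unfolding T_def F_def
    by (rule fps_transpose_eqI) (simp add: mult.assoc distrib_right fps_X_mult_nth)
  have F0: "F 0 = 1"
    unfolding F_def by (intro fps_ext) (simp add: forest_gf_0)
  have FS: "F (Suc j) = F j + T * (F j + fps_shift 1 (F j))" for j
  proof -
    have shift: "F j + fps_shift 1 (F j) = fps_transpose (\<lambda>n. forest_gf r j n + fps_shift 1 (forest_gf r j n))"
      unfolding F_def by (rule fps_transpose_eqI) simp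
    have "(\<Sum>i\<le>m. (if i = 0 then 0 else (1 + fps_X) * forest_gf r (Suc r) (i - 1)) *
          (forest_gf r j (m - i) + fps_shift 1 (forest_gf r j (m - i)))) = forest_gf r (Suc j) m - forest_gf r j m" for m
      unfolding sum.atMost_shift forest_gf_Suc[OF assms(1), of j m] by simp
    then show ?thesis
      unfolding T shift fps_transpose_mult by (intro fps_ext) (simp add: F_def)
  qed
  obtain m where m: "n = Suc m" using assms(2) by (cases n) auto
  have "real (card {w. r_permutation r {1..n} w \<and> stack_sort (stack_sort w) = [1..<n+1]}) =
      (\<Sum>p\<in>perms231 m. real (card (forests r (Suc r) p)))"
    unfolding card_twice_sorted[OF assms(1)] unfolding m sum_trees_eq_sum_forests[OF assms(1)] by simp
  also have "\<dots> = forest_gf r (Suc r) m $ 0"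
    by (simp add: forest_gf_def fps_sum_nth fps_mult_of_nat_nth fps_nth_power_0)
  \<comment> \<open>The factor \<open>x\<close> in \<open>T\<close> restores the deleted root, hence
    the index \<open>n = Suc m\<close>; the factor \<open>u\<close> is 1 at
    \<open>u = 1\<close>.\<close>
  also have "\<dots> = T $ 0 $ n" by (simp add: T m)
  also have "\<dots> = 2 * (real r + 1) * fact ((2 * r + 1) * n) / (fact n * fact (2 * r * n + 2))"
    by (rule catalytic_coefficient[OF F0 FS T_def assms(2)])
  finally show ?thesis .
qed

end
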